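(* Let $K$ be a real biquadratic field. Let $t\in\{0,1,2,3\}$ be the number of quadratic subfields of $K$ whose fundamental units have negative norm (i.e. norm $-1$ over $\mathbb{Q}$), and let $s_K$ be the number of prime numbers that are ramified in $K/\mathbb{Q}$. If $K$ is a P\'olya field, then $$s_K\le\begin{cases}5 & \text{if } t=0,\\ 4 & \text{if } t=1,\\ 3 & \text{if } t=2,3.\end{cases}$$
   Context: A real biquadratic field is a field $K=\mathbb{Q}(\sqrt{d_1},\sqrt{d_2})$ with $d_1,d_2\neq 1$ two different square-free positive integers; it has exactly three quadratic subfields, all real. For each positive integer $q$, the Ostrowski ideal $\Pi_q(K)$ is the product of all maximal ideals $\mathfrak{m}$ of the ring of integers $\mathcal{O}_K$ with norm $N_{K/\mathbb{Q}}(\mathfrak{m})=q$, with the convention $\Pi_q(K)=\mathcal{O}_K$ if there are no such ideals. The P\'olya group $\operatorname{Po}(K)$ is the subgroup of the ideal class group $\operatorname{Cl}(K)$ generated by the classes of all the ideals $\Pi_q(K)$. The field $K$ is called a P\'olya field if $\operatorname{Po}(K)$ is trivial, equivalently if all the ideals $\Pi_q(K)$ are principal. *)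

theory Defs
  imports
    "HOL-Algebra.Algebra"
    "HOL-Algebra.Algebraic_Closure_Type"
    "HOL-Computational_Algebra.Squarefree"
begin

text \<open>
  Number fields are represented by their carrier sets inside a fixed field of characteristic zero,
  and are turned into HOL-Algebra rings by restricting the carrier.
\<close>

abbreviation ring_on :: "'a::field_char_0 set \<Rightarrow> 'a ring" where
  "ring_on A \<equiv> ring_of_type_algebra\<lparr>carrier := A\<rparr>"

definition real_biquadratic_field :: "real set \<Rightarrow> bool" where
  "real_biquadratic_field K \<longleftrightarrow>
     (\<exists>d1 d2 :: nat. 0 < d1 \<and> 0 < d2 \<and> squarefree d1 \<and> squarefree d2 \<and>
        d1 \<noteq> 1 \<and> d2 \<noteq> 1 \<and> d1 \<noteq> d2 \<and>
        K = generate_field ring_of_type_algebra {sqrt (real d1), sqrt (real d2)})"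

definition quadratic_subfields :: "'a::field_char_0 set \<Rightarrow> 'a set set" where
  "quadratic_subfields K =
     {F. subfield F (ring_on K) \<and> ring.dimension (ring_on K) 2 \<rat> F}"

definition ring_of_integers :: "'a::field_char_0 set \<Rightarrow> 'a ring" where
  "ring_of_integers K = ring_on {x \<in> K. algebraic_int x}"

text \<open>Embeddings are cut down to \<^const>\<open>extensional\<close> functions, so that each embedding of
  \<open>K\<close> into the complex numbers is represented by exactly one HOL function.\<close>

definition complex_embeddings :: "'a::field_char_0 set \<Rightarrow> ('a \<Rightarrow> complex) set" where
  "complex_embeddings K = ring_hom (ring_on K) ring_of_type_algebra \<inter> extensional K"

definition field_norm :: "'a::field_char_0 set \<Rightarrow> 'a \<Rightarrow> complex" where
  "field_norm K x = (\<Prod>\<sigma>\<in>complex_embeddings K. \<sigma> x)"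

text \<open>
  A fundamental unit of a real quadratic field generates the unit group modulo
  \<open>{1, -1}\<close>. It is unique up to sign and inversion, neither of which affects a norm
  \<open>1\<close> or \<open>-1\<close> over the rationals.
\<close>

definition fundamental_unit :: "'a::field_char_0 set \<Rightarrow> 'a \<Rightarrow> bool" where
  "fundamental_unit F \<epsilon> \<longleftrightarrow>
     \<epsilon> \<in> Units (ring_of_integers F) \<and>
     Units (ring_of_integers F) = (\<Union>n::int. {\<epsilon> powi n, - (\<epsilon> powi n)})"

definition num_negative_norm_subfields :: "'a::field_char_0 set \<Rightarrow> nat" where
  "num_negative_norm_subfields K =
     card {F \<in> quadratic_subfields K. \<exists>\<epsilon>. fundamental_unit F \<epsilon> \<and> field_norm F \<epsilon> = -1}"

text \<open>
  The exponent \<open>e\<close> below is the ramification index of \<open>P\<close> over \<open>p\<close>: the exact power of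
  \<open>P\<close> in the factorisation of the extension of \<open>p\<close> to the ring of integers.
\<close>

definition ramified_prime :: "'a::field_char_0 set \<Rightarrow> nat \<Rightarrow> bool" where
  "ramified_prime K p \<longleftrightarrow>
     Factorial_Ring.prime p \<and>
     (\<exists>P J. \<exists>e::nat. maximalideal P (ring_of_integers K) \<and> ideal J (ring_of_integers K) \<and>
        \<not> J \<subseteq> P \<and> 2 \<le> e \<and>
        PIdl\<^bsub>ring_of_integers K\<^esub> (of_nat p) =
          (P [^]\<^bsub>ideals_set (ring_of_integers K)\<^esub> e) \<otimes>\<^bsub>ideals_set (ring_of_integers K)\<^esub> J)"

definition num_ramified_primes :: "'a::field_char_0 set \<Rightarrow> nat" where
  "num_ramified_primes K = card {p. ramified_prime K p}"

definition fractional_ideal :: "'a::field_char_0 set \<Rightarrow> 'a set \<Rightarrow> bool" where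
  "fractional_ideal K I \<longleftrightarrow>
     subgroup I (add_monoid (ring_on K)) \<and> I \<noteq> {0} \<and>
     (\<forall>a\<in>carrier (ring_of_integers K). \<forall>x\<in>I. a * x \<in> I) \<and>
     (\<exists>d\<in>carrier (ring_of_integers K). d \<noteq> 0 \<and> (\<forall>x\<in>I. d * x \<in> carrier (ring_of_integers K)))"

text \<open>\<^const>\<open>ideal_prod\<close> forms all finite nonempty sums of products, which is also the
  product of fractional ideals.\<close>

definition fractional_ideal_group :: "'a::field_char_0 set \<Rightarrow> 'a set monoid" where
  "fractional_ideal_group K =
     \<lparr>carrier = {I. fractional_ideal K I},
      monoid.mult = ideal_prod (ring_on K),
      one = carrier (ring_of_integers K)\<rparr>"

definition principal_fractional_ideals :: "'a::field_char_0 set \<Rightarrow> 'a set set" where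
  "principal_fractional_ideals K =
     (\<lambda>x. (\<lambda>a. x * a) ` carrier (ring_of_integers K)) ` (K - {0})"

definition class_group :: "'a::field_char_0 set \<Rightarrow> 'a set set monoid" where
  "class_group K = fractional_ideal_group K Mod principal_fractional_ideals K"

definition ideal_class :: "'a::field_char_0 set \<Rightarrow> 'a set \<Rightarrow> 'a set set" where
  "ideal_class K I = principal_fractional_ideals K #>\<^bsub>fractional_ideal_group K\<^esub> I"

text \<open>The absolute norm of a maximal ideal is the cardinality of its residue field. The empty
  product is the one of \<^const>\<open>ideals_set\<close>, i.e. the whole ring of integers.\<close>

definition ostrowski_ideal :: "'a::field_char_0 set \<Rightarrow> nat \<Rightarrow> 'a set" where
  "ostrowski_ideal K q =
     finprod (ideals_set (ring_of_integers K)) (\<lambda>\<mm>. \<mm>)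
       {\<mm>. maximalideal \<mm> (ring_of_integers K) \<and>
            card (carrier (ring_of_integers K Quot \<mm>)) = q}"

definition polya_group :: "'a::field_char_0 set \<Rightarrow> 'a set set set" where
  "polya_group K = generate (class_group K) {ideal_class K (ostrowski_ideal K q) | q. 0 < q}"

definition polya_field :: "'a::field_char_0 set \<Rightarrow> bool" where
  "polya_field K \<longleftrightarrow> polya_group K = {\<one>\<^bsub>class_group K\<^esub>}"

end

theory Submission
  imports Defs "Jordan_Normal_Form.Char_Poly"
begin

text \<open>
  If \<open>K\<close> is a Polya field, then for every ramified prime \<open>p\<close> the Ostrowski ideal above \<open>p\<close> has a
  generator \<open>a\<close>. All its conjugates are associated to it, so \<open>a\<^sup>4 = p\<^sup>j v\<close> for a unit \<open>v\<close>
  with \<open>1 \<le> j \<le> 3\<close>, and this yields \<open>b\<^sup>2 = p u\<close> with \<open>b \<in> K\<close> and a totally positive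
  unit \<open>u\<close>. A nonempty product of such primes is a square in \<open>K\<close> only if it is \<open>d\<^sub>1\<close>, \<open>d\<^sub>2\<close> or
  \<open>d\<^sub>1 d\<^sub>2\<close> up to rational squares; removing two suitable primes excludes this. The units \<open>u\<close> of the
  remaining primes are then independent modulo squares. Units of negative norm from different quadratic
  subfields are independent of them (and of \<open>-1\<close>) because of their signs, at least when one uses no
  more than two subfields. Since the unit group modulo \<open>-1\<close> and squares has rank at most three, we
  get \<open>(s - 2) + min t 2 \<le> 3\<close>.
\<close>

text \<open>The positive rationals that become squares in \<open>K\<close> form four classes modulo
  rational squares, a plane over F_2. Two primes suffice to detect its three nonzero vectors, hence
  the loss of 2. The restriction to two subfields comes from signs: every nontrivial automorphism
  moves exactly two of the roots \<open>s1\<close>, \<open>s2\<close>, \<open>s1 * s2\<close>, so in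
  a product of three units of negative norm the two sign changes cancel, and such a product can
  indeed be a square (as in Q(sqrt 2, sqrt 5)). This is why t = 3 gives the same bound as t = 2. The
  argument does without unique factorization of ideals. An Ostrowski ideal is handled as an
  intersection of maximal ideals, and valuations are replaced by one equation: the exponent 4 is the
  degree of \<open>K\<close>, since \<open>Nm a\<close> is the product of four numbers associated to
  \<open>a\<close> and divides \<open>p ^ 4\<close>. The ramification index is never computed; every
  exponent j from 1 to 3 leads to a root of \<open>p\<close> times a unit.\<close>

section \<open>Algebraic integers\<close>

text \<open>The determinant trick: \<open>v\<close> is nonzero because of \<open>i0\<close>, so
  \<open>z\<close> is an eigenvalue of an integer matrix and a root of its monic characteristic
  polynomial.\<close>

lemma algebraic_int_if_int_eigenvalue:
  fixes z :: "'a::field_char_0" and A :: "'b \<Rightarrow> 'b \<Rightarrow> int"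
  assumes I: "finite I" and i0: "i0 \<in> I" "v i0 \<noteq> 0"
    and eq: "\<And>i. i \<in> I \<Longrightarrow> z * v i = (\<Sum>j\<in>I. of_int (A i j) * v j)"
  shows "algebraic_int z"
proof -
  define n where "n = card I"
  obtain h where h: "bij_betw h {0..<n} I"
    using ex_bij_betw_nat_finite[OF I] by (auto simp: n_def)
  define M where "M = mat n n (\<lambda>(i,j). A (h i) (h j))"
  define M' :: "'a mat" where "M' = map_mat of_int M"
  define w where "w = vec n (\<lambda>i. v (h i))"
  have carr: "M \<in> carrier_mat n n" "M' \<in> carrier_mat n n" "w \<in> carrier_vec n"
    by (auto simp: M_def M'_def w_def)
  obtain k where k: "k < n" "h k = i0"
    using h i0 by (auto simp: bij_betw_def)
  have "w \<noteq> 0\<^sub>v n"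
  proof
    assume "w = 0\<^sub>v n"
    hence "w $ k = 0" using k by simp
    thus False using k i0 by (simp add: w_def)
  qed
  moreover have "M' *\<^sub>v w = z \<cdot>\<^sub>v w"
  proof (rule eq_vecI)
    fix i assume "i < dim_vec (z \<cdot>\<^sub>v w)"
    hence i: "i < n" by (simp add: w_def)
    have hi: "h i \<in> I" using h i by (auto simp: bij_betw_def)
    have "(M' *\<^sub>v w) $ i = (\<Sum>j\<in>{0..<n}. of_int (A (h i) (h j)) * v (h j))"
      using i by (simp add: M'_def M_def w_def scalar_prod_def)
    also have "\<dots> = (\<Sum>j\<in>I. of_int (A (h i) j) * v j)"
      by (rule sum.reindex_bij_betw[OF h])
    also have "\<dots> = z * v (h i)" using eq[OF hi] by simp
    finally show "(M' *\<^sub>v w) $ i = (z \<cdot>\<^sub>v w) $ i" using i by (simp add: w_def)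
  qed (auto simp: M'_def M_def w_def)
  ultimately have "eigenvalue M' z"
    using carr unfolding eigenvalue_def eigenvector_def by auto
  hence "poly (char_poly M') z = 0"
    using eigenvalue_root_char_poly[OF carr(2)] by simp
  moreover have "char_poly M' = map_poly of_int (char_poly M)"
    unfolding M'_def by (rule of_int_hom.char_poly_hom[OF carr(1)])
  ultimately show ?thesis
    using degree_monic_char_poly[OF carr(1)] unfolding algebraic_int_altdef_ipoly by auto
qed

definition int_span :: "('b \<Rightarrow> 'a::field_char_0) \<Rightarrow> 'b set \<Rightarrow> 'a set" where
  "int_span v I = {\<Sum>i\<in>I. of_int (c i) * v i | c. True}"

lemma int_span_0: "0 \<in> int_span v I"
  unfolding int_span_def by (auto intro: exI[of _ "\<lambda>_. 0"])

lemma int_span_add: "x \<in> int_span v I \<Longrightarrow> y \<in> int_span v I \<Longrightarrow> x + y \<in> int_span v I"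
  unfolding int_span_def
proof clarify
  fix c d :: "'b \<Rightarrow> int"
  show "\<exists>e. (\<Sum>i\<in>I. of_int (c i) * v i) + (\<Sum>i\<in>I. of_int (d i) * v i) =
          (\<Sum>i\<in>I. of_int (e i) * v i) \<and> True"
    by (rule exI[of _ "\<lambda>i. c i + d i"]) (simp add: sum.distrib distrib_right)
qed

lemma int_span_scale: "x \<in> int_span v I \<Longrightarrow> of_int k * x \<in> int_span v I"
  unfolding int_span_def
proof clarify
  fix c :: "'b \<Rightarrow> int"
  show "\<exists>e. of_int k * (\<Sum>i\<in>I. of_int (c i) * v i) = (\<Sum>i\<in>I. of_int (e i) * v i) \<and> True"
    by (rule exI[of _ "\<lambda>i. k * c i"]) (simp add: sum_distrib_left mult.assoc)
qed

lemma int_span_sum: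
  "(\<And>i. i \<in> A \<Longrightarrow> f i \<in> int_span v I) \<Longrightarrow> sum f A \<in> int_span v I"
  by (induction A rule: infinite_finite_induct) (auto intro: int_span_0 int_span_add)

lemma int_span_base:
  assumes "finite I" "i \<in> I"
  shows "v i \<in> int_span v I"
proof -
  have "v i = (\<Sum>j\<in>I. of_int (if j = i then 1 else 0) * v j)"
    using assms by (simp add: if_distrib[of of_int] if_distrib[of "\<lambda>x. x * _"] cong: if_cong)
  thus ?thesis unfolding int_span_def
    by (intro CollectI exI[of _ "\<lambda>j. if j = i then 1 else 0"]) auto
qed

lemma int_span_mult_closed:
  assumes "\<And>i. i \<in> I \<Longrightarrow> x * v i \<in> int_span v I" "y \<in> int_span v I"
  shows "x * y \<in> int_span v I"
proof -
  obtain c where "y = (\<Sum>i\<in>I. of_int (c i) * v i)" using assms(2) by (auto simp: int_span_def)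
  hence "x * y = (\<Sum>i\<in>I. of_int (c i) * (x * v i))"
    by (simp add: sum_distrib_left algebra_simps)
  thus ?thesis using assms(1) by (auto intro!: int_span_sum int_span_scale)
qed

lemma algebraic_int_if_int_span_closed:
  fixes z :: "'a::field_char_0"
  assumes "finite I" "i0 \<in> I" "v i0 \<noteq> 0"
    and "\<And>i. i \<in> I \<Longrightarrow> z * v i \<in> int_span v I"
  shows "algebraic_int z"
proof -
  have "\<forall>i\<in>I. \<exists>c. z * v i = (\<Sum>j\<in>I. of_int (c j) * v j)"
    using assms(4) by (auto simp: int_span_def)
  then obtain A where "\<forall>i\<in>I. z * v i = (\<Sum>j\<in>I. of_int (A i j) * v j)" by metis
  thus ?thesis using algebraic_int_if_int_eigenvalue[of I i0 v z A, OF assms(1-3)] by blast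
qed

lemma algebraic_int_power_eq:
  fixes x :: "'a::field_char_0"
  assumes "algebraic_int x"
  obtains n c where "n > 0" "x ^ n = (\<Sum>k<n. of_int (c k) * x ^ k)"
proof -
  obtain p where p: "poly (map_poly of_int p) x = 0" "lead_coeff p = 1"
    using assms unfolding algebraic_int_altdef_ipoly by auto
  define n where "n = degree p"
  have deg: "degree (map_poly of_int p :: 'a poly) = n" by (simp add: n_def)
  \<comment> \<open>A monic constant is 1, which has no root. Positive degrees are what puts the
    index \<open>(0,0)\<close>, with the nonzero monomial 1, into the spanning family for sums and
    products.\<close>
  have "n > 0"
  proof (rule ccontr)
    assume "\<not> n > 0"
    hence "degree p = 0" by (simp add: n_def)
    then obtain a where "p = [:a:]" using degree_eq_zeroE by blast
    hence "p = 1" using p(2) by (simp add: one_pCons)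
    thus False using p(1) by simp
  qed
  have "(\<Sum>k\<le>n. of_int (coeff p k) * x ^ k) = 0"
    using p(1) unfolding poly_altdef deg by (simp add: coeff_map_poly)
  moreover have "{..n} = insert n {..<n}" by auto
  ultimately have "x ^ n + (\<Sum>k<n. of_int (coeff p k) * x ^ k) = 0"
    using p(2) by (simp add: n_def)
  hence "x ^ n = (\<Sum>k<n. of_int (- coeff p k) * x ^ k)"
    by (simp add: sum_negf eq_neg_iff_add_eq_0)
  with \<open>n > 0\<close> show ?thesis by (rule that)
qed

text \<open>The Z-module spanned by the monomials \<open>x ^ i * y ^ j\<close> with
  \<open>i < n\<close> and \<open>j < m\<close> is stable under \<open>x\<close> and under
  \<open>y\<close>, since an overflowing power is rewritten by its monic equation. Hence it is
  stable under the sum and the product.\<close>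

lemma algebraic_int_add_mult:
  fixes x y :: "'a::field_char_0"
  assumes "algebraic_int x" "algebraic_int y"
  shows "algebraic_int (x + y)" "algebraic_int (x * y)"
proof -
  obtain n a where n: "n > 0" "x ^ n = (\<Sum>k<n. of_int (a k) * x ^ k)"
    using algebraic_int_power_eq[OF assms(1)] .
  obtain m b where m: "m > 0" "y ^ m = (\<Sum>k<m. of_int (b k) * y ^ k)"
    using algebraic_int_power_eq[OF assms(2)] .
  define I where "I = {..<n} \<times> {..<m}"
  define v where "v = (\<lambda>(i,j). x ^ i * y ^ j)"
  have I: "finite I" "(0,0) \<in> I" "v (0,0) \<noteq> 0" using n m by (auto simp: I_def v_def)
  have mem: "\<And>i j. i < n \<Longrightarrow> j < m \<Longrightarrow> (i,j) \<in> I" by (simp add: I_def)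
  have x: "x * v i \<in> int_span v I" if ii: "i \<in> I" for i
  proof -
    obtain k l where i: "i = (k,l)" "k < n" "l < m" using ii by (auto simp: I_def)
    show ?thesis
    proof (cases "Suc k < n")
      case True
      hence "(Suc k, l) \<in> I" using i by (auto simp: I_def)
      from int_span_base[OF I(1) this, of v] show ?thesis by (simp add: i v_def algebra_simps)
    next
      case False
      hence "Suc k = n" using i by simp
      hence "x * v i = x ^ n * y ^ l" using i by (auto simp: v_def)
      also have "\<dots> = (\<Sum>k<n. of_int (a k) * v (k,l))"
        unfolding n(2) by (simp add: sum_distrib_right v_def mult.assoc)
      finally show ?thesis using i
        by (auto intro!: int_span_sum int_span_scale int_span_base[OF I(1), of _ v] mem)
    qed
  qed
  have y: "y * v i \<in> int_span v I" if ii: "i \<in> I" for i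
  proof -
    obtain k l where i: "i = (k,l)" "k < n" "l < m" using ii by (auto simp: I_def)
    show ?thesis
    proof (cases "Suc l < m")
      case True
      hence "(k, Suc l) \<in> I" using i by (auto simp: I_def)
      from int_span_base[OF I(1) this, of v] show ?thesis by (simp add: i v_def algebra_simps)
    next
      case False
      hence "Suc l = m" using i by simp
      hence "y * v i = x ^ k * y ^ m" using i by (auto simp: v_def)
      also have "\<dots> = (\<Sum>l<m. of_int (b l) * v (k,l))"
        unfolding m(2) by (simp add: sum_distrib_left v_def algebra_simps)
      finally show ?thesis using i
        by (auto intro!: int_span_sum int_span_scale int_span_base[OF I(1), of _ v] mem)
    qed
  qed
  show "algebraic_int (x + y)"
    by (rule algebraic_int_if_int_span_closed[of I "(0,0)" v, OF I])
       (auto simp: distrib_right intro: int_span_add x y)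
  show "algebraic_int (x * y)"
    by (rule algebraic_int_if_int_span_closed[of I "(0,0)" v, OF I])
       (auto simp: mult.assoc intro: int_span_mult_closed x y)
qed

section \<open>Integer approximation and multiplicities\<close>

text \<open>Pigeonhole principle: there are \<open>M ^ card I\<close> exponent vectors with entries below \<open>M\<close>, but only
  \<open>O(M ^ card J)\<close> values for the integer parts of the linear forms.\<close>

lemma small_integer_combination:
  fixes L :: "'j \<Rightarrow> 'i \<Rightarrow> real"
  assumes "finite I" "finite J" "card J < card I"
  shows "\<exists>c :: 'i \<Rightarrow> int. (\<exists>i\<in>I. c i \<noteq> 0) \<and> (\<forall>j\<in>J. \<bar>\<Sum>i\<in>I. of_int (c i) * L j i\<bar> < 1)"
proof -
  define B where "B = (\<Sum>j\<in>J. \<Sum>i\<in>I. \<bar>L j i\<bar>)"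
  have "B \<ge> 0" by (simp add: B_def sum_nonneg)
  obtain C :: nat where C: "B < real C" using reals_Archimedean2 by blast
  hence "C > 0" using \<open>B \<ge> 0\<close> by (cases C) auto
  \<comment> \<open>Since \<open>C > B\<close>, the floors for coefficients below \<open>M\<close>
    lie in an interval of \<open>2 * C * M\<close> integers. This \<open>M\<close> makes
    \<open>(2 * (C * M)) ^ card J\<close> smaller than \<open>M ^ Suc (card J)\<close>, so there are
    fewer boxes than vectors.\<close>
  define M where "M = (2 * C) ^ card J + 1"
  define Xs where "Xs = FuncSet.PiE I (\<lambda>_. {..<M})"
  define Ys where "Ys = FuncSet.PiE J (\<lambda>_. {- int (C * M)..<int (C * M)})"
  define F where "F = (\<lambda>a. \<lambda>j\<in>J. \<lfloor>\<Sum>i\<in>I. real (a i) * L j i\<rfloor>)"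
  have "M > 0" by (simp add: M_def)
  have "F a \<in> Ys" if a: "a \<in> Xs" for a
  proof -
    have "\<lfloor>\<Sum>i\<in>I. real (a i) * L j i\<rfloor> \<in> {- int (C * M)..<int (C * M)}" if "j \<in> J" for j
    proof -
      have "\<bar>\<Sum>i\<in>I. real (a i) * L j i\<bar> \<le> (\<Sum>i\<in>I. \<bar>real (a i) * L j i\<bar>)" by (rule sum_abs)
      also have "\<dots> \<le> (\<Sum>i\<in>I. real M * \<bar>L j i\<bar>)"
        using a by (intro sum_mono) (auto simp: abs_mult Xs_def PiE_def Pi_def intro!: mult_right_mono)
      also have "\<dots> = real M * (\<Sum>i\<in>I. \<bar>L j i\<bar>)" by (simp add: sum_distrib_left)
      also have "\<dots> \<le> real M * B"
        unfolding B_def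
        by (intro mult_left_mono member_le_sum) (use that assms in \<open>auto intro: sum_nonneg\<close>)
      also have "real M * B < real M * real C" using C \<open>M > 0\<close> by simp
      finally have "\<bar>\<Sum>i\<in>I. real (a i) * L j i\<bar> < real C * real M" by (simp only: mult.commute)
      thus ?thesis by (auto simp: floor_less_iff le_floor_iff)
    qed
    thus ?thesis by (auto simp: F_def Ys_def)
  qed
  hence img: "F ` Xs \<subseteq> Ys" by blast
  have "card {- int k..<int k} = 2 * k" for k by simp
  hence "card Ys = (2 * (C * M)) ^ card J"
    unfolding Ys_def by (simp only: card_PiE[OF assms(2)] prod_constant)
  also have "\<dots> < M ^ card J * M"
  proof -
    have "(2 * (C * M)) ^ card J = M ^ card J * (2 * C) ^ card J" by (simp add: power_mult_distrib mult_ac)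
    also have "\<dots> < M ^ card J * M" using \<open>M > 0\<close> by (simp add: M_def)
    finally show ?thesis .
  qed
  also have "\<dots> = M ^ Suc (card J)" by simp
  also have "\<dots> \<le> M ^ card I" using assms \<open>M > 0\<close> by (intro power_increasing) auto
  also have "\<dots> = card Xs" unfolding Xs_def using assms by (simp add: card_PiE)
  finally have "card Ys < card Xs" .
  moreover have "finite Ys" unfolding Ys_def using assms by (auto intro: finite_PiE)
  ultimately have "\<not> inj_on F Xs" using img by (metis card_inj_on_le not_less)
  then obtain a b where ab: "a \<in> Xs" "b \<in> Xs" "F a = F b" "a \<noteq> b" by (auto simp: inj_on_def)
  define c where "c = (\<lambda>i. int (a i) - int (b i))"
  have "\<exists>i\<in>I. c i \<noteq> 0"
  proof (rule ccontr)
    assume "\<not> ?thesis"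
    hence "a i = b i" if "i \<in> I" for i using that by (auto simp: c_def)
    hence "a = b" using ab(1,2) unfolding Xs_def by (rule PiE_ext[rotated 2])
    thus False using ab by simp
  qed
  moreover have "\<bar>\<Sum>i\<in>I. of_int (c i) * L j i\<bar> < 1" if "j \<in> J" for j
  proof -
    have "F a j = F b j" using ab by simp
    hence "\<lfloor>\<Sum>i\<in>I. real (a i) * L j i\<rfloor> = \<lfloor>\<Sum>i\<in>I. real (b i) * L j i\<rfloor>" using that by (simp add: F_def)
    hence "\<bar>(\<Sum>i\<in>I. real (a i) * L j i) - (\<Sum>i\<in>I. real (b i) * L j i)\<bar> < 1" by linarith
    thus ?thesis by (simp add: c_def sum_subtractf left_diff_distrib)
  qed
  ultimately show ?thesis by blast
qed

text \<open>Meant for a unit \<open>w\<close> of norm 1 or -1 in a quadratic field, whose trace is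
  \<open>w + 1 / w\<close> or \<open>w - 1 / w\<close>. In the window, which is symmetric under
  inversion, t = |w| satisfies 2 <= t + 1/t < 3 and |t - 1/t| < 1, so the integer is 2 or 0, and
  both give t = 1.\<close>

lemma abs_eq_1_if_near_1:
  fixes w :: real
  assumes "w + 1 / w \<in> \<int> \<or> w - 1 / w \<in> \<int>" "2 / 3 < \<bar>w\<bar>" "\<bar>w\<bar> < 3 / 2"
  shows "\<bar>w\<bar> = 1"
proof -
  define t where "t = \<bar>w\<bar>"
  have t: "2 / 3 < t" "t < 3 / 2" using assms by (auto simp: t_def)
  have "t = w \<or> t = - w" by (auto simp: t_def)
  hence "t + 1 / t \<in> \<int> \<or> t - 1 / t \<in> \<int>"
  proof
    assume "t = - w"
    hence "t + 1 / t = - (w + 1 / w)" "t - 1 / t = - (w - 1 / w)" by simp_all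
    thus ?thesis using assms(1) by (metis Ints_minus)
  qed (use assms(1) in simp)
  thus ?thesis
  proof
    assume "t + 1 / t \<in> \<int>"
    then obtain k where k: "t + 1 / t = of_int k" by (auto elim: Ints_cases)
    have "1 / t < 3 / 2" using t by (simp add: divide_less_eq)
    hence "t + 1 / t < 3" using t by linarith
    moreover have "t + 1 / t - 2 = (t - 1)\<^sup>2 / t"
    proof -
      have "(t - 1)\<^sup>2 = t * t - 2 * t + 1" by (simp add: power2_eq_square algebra_simps)
      thus ?thesis using t by (simp add: add_divide_distrib diff_divide_distrib)
    qed
    hence eq: "t + 1 / t = 2 + (t - 1)\<^sup>2 / t" by simp
    moreover have "(t - 1)\<^sup>2 / t \<ge> 0" using t by simp
    ultimately have "2 \<le> t + 1 / t" "t + 1 / t < 3" by linarith+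
    hence "k = 2" unfolding k by linarith
    hence "(t - 1)\<^sup>2 = 0" using k t eq by auto
    thus ?thesis by (simp add: t_def)
  next
    assume "t - 1 / t \<in> \<int>"
    then obtain k where k: "t - 1 / t = of_int k" by (auto elim: Ints_cases)
    have "1 / t < 3 / 2" "1 / t > 2 / 3" using t by (auto simp: divide_less_eq less_divide_eq)
    hence "\<bar>t - 1 / t\<bar> < 1" using t by linarith
    hence "k = 0" unfolding k by linarith
    hence "t = 1 / t" using k by simp
    hence "t * t = 1" using t by (metis nonzero_eq_divide_eq less_numeral_extra(3) divide_pos_pos zero_less_numeral less_trans)
    hence "(t - 1) * (t + 1) = 0" by (simp add: algebra_simps)
    hence "t = 1" using t by auto
    thus ?thesis by (simp add: t_def)
  qed
qed

lemma ln_abs_power_int: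
  fixes x :: real
  assumes "x \<noteq> 0"
  shows "ln \<bar>x powi k\<bar> = of_int k * ln \<bar>x\<bar>"
proof (cases "k \<ge> 0")
  case True
  thus ?thesis using assms by (simp add: power_int_def power_abs ln_realpow)
next
  case False
  thus ?thesis using assms by (simp add: power_int_def power_abs ln_realpow ln_inverse)
qed

lemma odd_multiplicity_if_sqrt_irrational:
  assumes "s\<^sup>2 = real n" "s \<notin> \<rat>"
  shows "\<exists>p::nat. Factorial_Ring.prime p \<and> odd (multiplicity p n)"
proof (rule ccontr)
  assume "\<not> ?thesis"
  moreover have "n \<noteq> 0"
  proof
    assume "n = 0"
    with assms(1) have "s = 0" by simp
    with assms(2) show False by simp
  qed
  ultimately have "is_nth_power 2 n"
    using is_nth_power_conv_multiplicity[of 2 n] by auto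
  then obtain m where "n = m\<^sup>2" by (auto simp: is_nth_power_def)
  hence "s\<^sup>2 = (real m)\<^sup>2" using assms by simp
  hence "s = real m \<or> s = - real m" by (simp add: power2_eq_iff)
  thus False using assms(2) by auto
qed

text \<open>After clearing the denominator of \<open>q\<close>, both sides are multiplied by
  squares, which contribute even multiplicities.\<close>

lemma parity_multiplicity_if_square_ratio:
  fixes m n :: nat
  assumes "m > 0" "n > 0" "q \<in> \<rat>" "real m = q\<^sup>2 * real n" "Factorial_Ring.prime p"
  shows "even (multiplicity p m) \<longleftrightarrow> even (multiplicity p n)"
proof -
  obtain a b :: int where ab: "b > 0" "q = of_int a / of_int b"
    using assms(3) by (elim Rats_cases') 
  define a' b' where "a' = nat \<bar>a\<bar>" and "b' = nat b"
  have q: "q\<^sup>2 = (real a')\<^sup>2 / (real b')\<^sup>2" using ab by (simp add: a'_def b'_def power_divide)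
  have "b' > 0" using ab by (simp add: b'_def)
  hence "real m * (real b')\<^sup>2 = (real a')\<^sup>2 * real n" using assms(4) unfolding q by simp
  hence "real (m * b'\<^sup>2) = real (a'\<^sup>2 * n)" by simp
  hence eq: "m * b'\<^sup>2 = a'\<^sup>2 * n" by (simp only: of_nat_eq_iff)
  have "a' \<noteq> 0"
  proof
    assume "a' = 0"
    hence "m * b'\<^sup>2 = 0" using eq by simp
    thus False using assms(1) \<open>b' > 0\<close> by simp
  qed
  have p: "prime_elem p" using assms(5) by simp
  have "multiplicity p (m * b'\<^sup>2) = multiplicity p m + 2 * multiplicity p b'"
    using assms(1) \<open>b' > 0\<close> p by (simp add: prime_elem_multiplicity_mult_distrib prime_elem_multiplicity_power_distrib)
  moreover have "multiplicity p (a'\<^sup>2 * n) = 2 * multiplicity p a' + multiplicity p n"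
    using assms(2) \<open>a' \<noteq> 0\<close> p by (simp add: prime_elem_multiplicity_mult_distrib prime_elem_multiplicity_power_distrib)
  ultimately have "multiplicity p m + 2 * multiplicity p b' = 2 * multiplicity p a' + multiplicity p n"
    using eq by simp
  thus ?thesis by presburger
qed

lemma multiplicity_prod_primes:
  assumes "finite A" "\<And>p. p \<in> A \<Longrightarrow> Factorial_Ring.prime p" "Factorial_Ring.prime (r::nat)"
  shows "multiplicity r (\<Prod>A) = (if r \<in> A then 1 else 0)"
proof -
  have "multiplicity r (prod id A) = (\<Sum>p\<in>A. multiplicity r (id p))"
  proof (rule prime_elem_multiplicity_prod_distrib)
    show "0 \<notin> id ` A" using assms(2)[of 0] by auto
  qed (use assms in auto)
  also have "\<dots> = (\<Sum>p\<in>A. if p = r then 1 else 0)"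
    using assms by (intro sum.cong refl) (auto simp: multiplicity_self prime_multiplicity_other)
  finally show ?thesis using assms(1) by (simp add: id_def)
qed

section \<open>Restricted rings and irrational square roots\<close>

lemma ring_on_simps [simp]:
  "carrier (ring_on A) = A" "x \<otimes>\<^bsub>ring_on A\<^esub> y = x * y" "x \<oplus>\<^bsub>ring_on A\<^esub> y = x + y"
  "\<one>\<^bsub>ring_on A\<^esub> = 1" "\<zero>\<^bsub>ring_on A\<^esub> = 0" for x y :: real
  by (simp_all add: ring_of_type_algebra_def)

lemma type_ring_simps [simp]:
  "carrier (ring_of_type_algebra) = UNIV" "x \<otimes>\<^bsub>ring_of_type_algebra\<^esub> y = x * y"
  "x \<oplus>\<^bsub>ring_of_type_algebra\<^esub> y = x + y"
  "\<one>\<^bsub>ring_of_type_algebra\<^esub> = 1" "\<zero>\<^bsub>ring_of_type_algebra\<^esub> = 0" for x y :: "'b::field_char_0"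
  by (simp_all add: ring_of_type_algebra_def)

lemma ring_hom_to_complex_rat:
  assumes h: "h \<in> Ring.ring_hom (ring_on A) (ring_of_type_algebra :: complex ring)"
    and A: "\<rat> \<subseteq> (A :: real set)" and r: "r \<in> \<rat>"
  shows "h r = complex_of_real r"
proof -
  have add: "h (x + y) = h x + h y" if "x \<in> \<rat>" "y \<in> \<rat>" for x y
    using Ring.ring_hom_add[OF h, of x y] A that by auto
  have mult: "h (x * y) = h x * h y" if "x \<in> \<rat>" "y \<in> \<rat>" for x y
    using Ring.ring_hom_mult[OF h, of x y] A that by auto
  have one: "h 1 = 1" using Ring.ring_hom_one[OF h] by simp
  have zero: "h 0 = 0" using add[of 0 0] by simp
  have nat: "h (of_nat n) = of_nat n" for n by (induction n) (simp_all add: zero add one)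
  have minus: "h (- x) = - h x" if "x \<in> \<rat>" for x
    using add[of x "- x"] that zero by (simp add: eq_neg_iff_add_eq_0 add.commute)
  have int: "h (of_int k) = of_int k" for k
    by (cases k) (simp_all add: nat minus del: of_nat_Suc)
  obtain a b :: int where ab: "b > 0" "r = of_int a / of_int b"
    using r by (elim Rats_cases')
  have "r * of_int b = of_int a" using ab by simp
  hence "h r * of_int b = of_int a"
    using mult[OF r, of "of_int b"] by (simp add: int)
  hence "h r = of_int a / of_int b" using ab(1) by (simp add: nonzero_eq_divide_eq)
  thus ?thesis by (simp add: ab(2))
qed

lemma sqrt_squarefree_irrational:
  assumes "squarefree (d::nat)" "d \<noteq> 1"
  shows "sqrt (real d) \<notin> \<rat>"
proof
  assume "sqrt (real d) \<in> \<rat>"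
  moreover have "algebraic_int (sqrt (real d))" by auto
  ultimately have "sqrt (real d) \<in> \<int>" by (rule rational_algebraic_int_is_int[rotated])
  then obtain k where "sqrt (real d) = of_int k" by (auto elim: Ints_cases)
  hence "real d = (of_int k)\<^sup>2" by (metis of_nat_0_le_iff real_sqrt_pow2)
  hence "int d = k\<^sup>2" by (metis of_int_eq_iff of_int_of_nat_eq of_int_power)
  hence "d = (nat \<bar>k\<bar>)\<^sup>2" by (metis nat_int nat_power_eq abs_ge_zero power2_abs)
  hence "nat \<bar>k\<bar> dvd 1" using assms(1) squarefreeD[of d "nat \<bar>k\<bar>"] by simp
  thus False using assms(2) \<open>d = _\<close> by simp
qed

text \<open>If the product were rational, \<open>c / d\<close> would be a rational square, so the
  multiplicities in \<open>c\<close> and \<open>d\<close> would agree modulo 2. By squarefreeness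
  they are at most 1, hence equal.\<close>

lemma sqrt_mult_squarefree_irrational:
  fixes c d :: nat
  assumes "squarefree c" "squarefree d" "c \<noteq> d"
  shows "sqrt (real c) * sqrt (real d) \<notin> \<rat>"
proof
  assume rat: "sqrt (real c) * sqrt (real d) \<in> \<rat>"
  have pos: "c > 0" "d > 0" using assms by (auto intro!: gr0I)
  have mult: "multiplicity p c = multiplicity p d" if p: "Factorial_Ring.prime p" for p :: nat
  proof -
    have le: "multiplicity p k \<le> 1" if k: "squarefree k" "k > 0" for k :: nat
    proof (rule ccontr)
      assume "\<not> ?thesis"
      hence "p\<^sup>2 dvd k" by (intro multiplicity_dvd') auto
      thus False using squarefreeD[OF k(1)] p not_prime_unit by blast
    qed
    have "(sqrt (real c) * sqrt (real d) / real d)\<^sup>2 = real c * real d / (real d)\<^sup>2"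
      by (simp add: power_mult_distrib power_divide)
    moreover have "real c = real c * real d / (real d)\<^sup>2 * real d"
      using pos by (simp add: power2_eq_square)
    ultimately have "real c = (sqrt (real c) * sqrt (real d) / real d)\<^sup>2 * real d" by simp
    hence "even (multiplicity p c) = even (multiplicity p d)"
      using rat pos p by (intro parity_multiplicity_if_square_ratio) auto
    thus ?thesis using le[OF assms(1) pos(1)] le[OF assms(2) pos(2)]
      by (auto simp: le_Suc_eq)
  qed
  have "c = d" by (rule multiplicity_eq_nat[OF pos mult])
  thus False using assms by simp
qed

section \<open>The biquadratic field and its automorphisms\<close>

text \<open>The roots are arguments so that one coordinate vector can be evaluated at all four
  choices of signs; this is where the automorphisms come from.\<close>

fun quad :: "real \<Rightarrow> real \<Rightarrow> rat \<times> rat \<times> rat \<times> rat \<Rightarrow> real" where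
  "quad t1 t2 (a,b,c,d) = of_rat a + of_rat b * t1 + of_rat c * t2 + of_rat d * (t1 * t2)"

text \<open>The irrationality assumptions say that none of \<open>D1\<close>, \<open>D2\<close>,
  \<open>D1 * D2\<close> is a rational square, which makes the degree four and treats the three
  quadratic subfields alike.\<close>

locale biquadratic =
  fixes s1 s2 :: real and D1 D2 :: nat
  assumes s1: "s1\<^sup>2 = real D1" and s2: "s2\<^sup>2 = real D2"
    and irrational: "s1 \<notin> \<rat>" "s2 \<notin> \<rat>" "s1 * s2 \<notin> \<rat>"
begin

definition K :: "real set" where "K = range (quad s1 s2)"

text \<open>For signs \<open>e, f\<close> this is the automorphism of \<open>K\<close> with \<open>s1 \<mapsto> e s1\<close> and \<open>s2 \<mapsto> f s2\<close>;
  it is a junk value outside \<open>K\<close>.\<close>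

definition conj :: "real \<Rightarrow> real \<Rightarrow> real \<Rightarrow> real" where
  "conj e f x = quad (e * s1) (f * s2) (inv_into UNIV (quad s1 s2) x)"

abbreviation signs :: "real set" where "signs \<equiv> {1,-1}"

text \<open>First 1 and \<open>s1\<close> are independent. A relation with nonzero coefficient of
  \<open>s2\<close> over Q(s1) gives \<open>s2 = f + g * s1\<close>; squaring forces
  \<open>f * g = 0\<close>, so \<open>s2\<close> or \<open>s1 * s2\<close> would be
  rational.\<close>

lemma quad_eq_0: 
  assumes "quad s1 s2 (a,b,c,d) = 0" shows "a = 0 \<and> b = 0 \<and> c = 0 \<and> d = 0"
proof -
  have r0: "p = 0 \<and> q = 0" if "of_rat p + of_rat q * s1 = 0" for p q
  proof (cases "q = 0")
    case False
    hence "s1 = of_rat (- p / q)" using that by (simp add: of_rat_divide of_rat_minus field_simps)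
    thus ?thesis using irrational(1) by (metis Rats_of_rat)
  qed (use that in simp)
  have eq: "of_rat a + of_rat b * s1 + s2 * (of_rat c + of_rat d * s1) = 0"
    using assms by (simp add: algebra_simps)
  have "of_rat c + of_rat d * s1 = 0"
  proof (rule ccontr)
    assume nz: "of_rat c + of_rat d * s1 \<noteq> 0"
    define n where "n = c * c - d * d * of_nat D1"
    have nn: "of_rat n = (of_rat c + of_rat d * s1) * (of_rat c - of_rat d * s1)"
      using s1 by (simp add: n_def of_rat_diff of_rat_mult algebra_simps power2_eq_square)
    have "n \<noteq> 0"
    proof
      assume "n = 0"
      hence "of_rat c + of_rat (-d) * s1 = 0" using nn nz by (simp add: of_rat_minus)
      hence "c = 0" "d = 0" using r0[of c "-d"] by auto
      thus False using nz by simp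
    qed
    \<comment> \<open>The coordinates of \<open>- (a + b * s1) / (c + d * s1)\<close>, found by
      expanding with the conjugate of the denominator, whose norm is \<open>n\<close>.\<close>
    define f g where "f = - (a * c - b * d * of_nat D1) / n" and "g = (a * d - b * c) / n"
    have "s2 * of_rat n = - (of_rat a + of_rat b * s1) * (of_rat c - of_rat d * s1)"
    proof -
      have "s2 * (of_rat c + of_rat d * s1) = - (of_rat a + of_rat b * s1)"
        using eq by simp
      thus ?thesis unfolding nn by (metis mult.assoc)
    qed
    also have "\<dots> = of_rat (f * n) + of_rat (g * n) * s1"
      using \<open>n \<noteq> 0\<close> s1 by (simp add: f_def g_def of_rat_mult of_rat_diff of_rat_minus of_rat_add algebra_simps power2_eq_square)
    finally have "s2 * of_rat n = (of_rat f + of_rat g * s1) * of_rat n"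
      by (simp add: of_rat_mult algebra_simps)
    hence s2': "s2 = of_rat f + of_rat g * s1" using \<open>n \<noteq> 0\<close> by simp
    have "of_nat D2 = (of_rat f + of_rat g * s1)\<^sup>2" using s2 s2' by simp
    also have "\<dots> = of_rat (f * f + g * g * of_nat D1) + of_rat (2 * f * g) * s1"
      using s1 by (simp add: of_rat_mult of_rat_add algebra_simps power2_eq_square)
    finally have "of_rat (f * f + g * g * of_nat D1 - of_nat D2) + of_rat (2 * f * g) * s1 = 0"
      by (simp add: of_rat_diff)
    hence "f * g = 0" using r0 by fastforce
    thus False
    proof (cases "g = 0")
      case True
      thus False using s2' irrational(2) by simp
    next
      case False
      hence "s2 = of_rat g * s1" using \<open>f * g = 0\<close> s2' by simp
      hence "s1 * s2 = of_rat g * s1\<^sup>2" by (simp add: power2_eq_square)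
      hence "s1 * s2 = of_rat (g * of_nat D1)" using s1 by (simp add: of_rat_mult)
      thus False using irrational(3) by (metis Rats_of_rat)
    qed
  qed
  moreover have "of_rat a + of_rat b * s1 = 0" using eq calculation by simp
  ultimately show ?thesis using r0 by blast
qed

fun qadd :: "rat \<times> rat \<times> rat \<times> rat \<Rightarrow> rat \<times> rat \<times> rat \<times> rat \<Rightarrow> rat \<times> rat \<times> rat \<times> rat" where
  "qadd (a,b,c,d) (a',b',c',d') = (a + a', b + b', c + c', d + d')"

lemma quad_add: "quad t1 t2 x + quad t1 t2 y = quad t1 t2 (qadd x y)"
  by (cases x; cases y) (simp add: of_rat_add algebra_simps)

lemma inj_quad: "inj (quad s1 s2)"
proof (rule injI)
  fix x y assume eq: "quad s1 s2 x = quad s1 s2 y"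
  obtain a b c d a' b' c' d' where xy: "x = (a,b,c,d)" "y = (a',b',c',d')" by (metis prod_cases4)
  have "quad s1 s2 (a - a', b - b', c - c', d - d') = 0"
    using eq by (simp add: xy of_rat_diff algebra_simps)
  from quad_eq_0[OF this] show "x = y" using xy by simp
qed

fun qmul :: "rat \<times> rat \<times> rat \<times> rat \<Rightarrow> rat \<times> rat \<times> rat \<times> rat \<Rightarrow> rat \<times> rat \<times> rat \<times> rat" where
  "qmul (a,b,c,d) (a',b',c',d') =
     (a * a' + b * b' * of_nat D1 + c * c' * of_nat D2 + d * d' * of_nat D1 * of_nat D2,
      a * b' + b * a' + (c * d' + d * c') * of_nat D2,
      a * c' + c * a' + (b * d' + d * b') * of_nat D1,
      a * d' + d * a' + b * c' + c * b')"

text \<open>Only the squares of the roots enter \<open>qmul\<close>, so the same formula holds after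
  any change of signs. This is what makes \<open>conj\<close> multiplicative.\<close>

lemma quad_mult:
  assumes "t1\<^sup>2 = real D1" "t2\<^sup>2 = real D2"
  shows "quad t1 t2 x * quad t1 t2 y = quad t1 t2 (qmul x y)"
proof -
  have D: "real D1 = t1 * t1" "real D2 = t2 * t2" using assms by (simp_all add: power2_eq_square)
  obtain a b c d a' b' c' d' where "x = (a,b,c,d)" "y = (a',b',c',d')" by (metis prod_cases4)
  thus ?thesis by (simp add: of_rat_add of_rat_mult D) (simp add: algebra_simps)
qed

lemma conj_quad: "conj e f (quad s1 s2 x) = quad (e * s1) (f * s2) x"
  by (simp add: conj_def inv_f_f[OF inj_quad])

lemma KE: assumes "x \<in> K" obtains q where "x = quad s1 s2 q" using assms by (auto simp: K_def)

lemma quad_in_K: "quad s1 s2 q \<in> K" by (simp add: K_def)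

lemma signs_sq: "e \<in> signs \<Longrightarrow> (e * s1)\<^sup>2 = real D1" "e \<in> signs \<Longrightarrow> (e * s2)\<^sup>2 = real D2"
  using s1 s2 by (auto simp: power_mult_distrib)

lemma quad_sign: "e \<in> signs \<Longrightarrow> f \<in> signs \<Longrightarrow> quad (e * s1) (f * s2) (a,b,c,d) = 
   quad s1 s2 (a, if e = 1 then b else - b, if f = 1 then c else - c, if e = f then d else - d)"
  by (auto simp: of_rat_minus)

lemma conj_in_K [simp, intro]: "x \<in> K \<Longrightarrow> e \<in> signs \<Longrightarrow> f \<in> signs \<Longrightarrow> conj e f x \<in> K"
  by (elim KE) (metis conj_quad quad_sign quad_in_K prod_cases4)

lemma K_add [simp, intro]: "x \<in> K \<Longrightarrow> y \<in> K \<Longrightarrow> x + y \<in> K"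
  by (metis KE quad_add quad_in_K)

lemma K_mult [simp, intro]: "x \<in> K \<Longrightarrow> y \<in> K \<Longrightarrow> x * y \<in> K"
  by (metis KE quad_mult[OF s1 s2] quad_in_K)

lemma K_rat: "x \<in> \<rat> \<Longrightarrow> x \<in> K"
proof (elim Rats_cases)
  fix r assume "x = of_rat r"
  hence "x = quad s1 s2 (r,0,0,0)" by simp
  thus "x \<in> K" using quad_in_K by metis
qed

lemma conj_rat: "x \<in> \<rat> \<Longrightarrow> conj e f x = x"
proof (elim Rats_cases)
  fix r assume "x = of_rat r"
  hence "x = quad s1 s2 (r,0,0,0)" by simp
  thus "conj e f x = x" by (simp only: conj_quad) simp
qed

lemma conj_0 [simp]: "conj e f 0 = 0" and conj_1 [simp]: "conj e f 1 = 1"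
  and conj_of_int [simp]: "conj e f (of_int k) = of_int k"
  and conj_of_nat [simp]: "conj e f (of_nat n) = of_nat n"
  by (simp_all add: conj_rat)

lemma K_1 [simp]: "1 \<in> K" and K_0 [simp]: "0 \<in> K" and K_of_int [simp]: "of_int k \<in> K"
  and K_of_nat [simp]: "of_nat n \<in> K"
  by (simp_all add: K_rat)

lemma K_minus [simp, intro]: "x \<in> K \<Longrightarrow> - x \<in> K"
  using K_mult[of "-1" x] K_rat[of "-1"] by simp

lemma K_diff [simp, intro]: "x \<in> K \<Longrightarrow> y \<in> K \<Longrightarrow> x - y \<in> K"
  by (metis K_add K_minus diff_conv_add_uminus)

lemma conj_add: "x \<in> K \<Longrightarrow> y \<in> K \<Longrightarrow> conj e f (x + y) = conj e f x + conj e f y"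
  by (elim KE) (simp add: conj_quad quad_add)

lemma conj_mult:
  "x \<in> K \<Longrightarrow> y \<in> K \<Longrightarrow> e \<in> signs \<Longrightarrow> f \<in> signs \<Longrightarrow> conj e f (x * y) = conj e f x * conj e f y"
  by (elim KE) (simp only: conj_quad quad_mult[OF s1 s2] quad_mult[OF signs_sq(1) signs_sq(2)])

lemma conj_minus: "x \<in> K \<Longrightarrow> e \<in> signs \<Longrightarrow> f \<in> signs \<Longrightarrow> conj e f (- x) = - conj e f x"
  using conj_add[of x "-x" e f] K_minus[of x] by simp

lemma conj_quad': "e \<in> signs \<Longrightarrow> f \<in> signs \<Longrightarrow> conj e f (quad s1 s2 (a,b,c,d)) =
   quad s1 s2 (a, if e = 1 then b else - b, if f = 1 then c else - c, if e = f then d else - d)"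
  by (simp only: conj_quad quad_sign)

lemma conj_conj:
  assumes "x \<in> K" "e \<in> signs" "f \<in> signs" "e' \<in> signs" "f' \<in> signs"
  shows "conj e f (conj e' f' x) = conj (e * e') (f * f') x"
proof -
  obtain a b c d where x: "x = quad s1 s2 (a,b,c,d)" using assms(1) by (metis KE prod_cases4)
  have "e * e' \<in> signs" "f * f' \<in> signs" using assms by auto
  thus ?thesis using assms(2-5) unfolding x
    by (simp only: conj_quad') (elim insertE emptyE; simp del: quad.simps)
qed

lemma conj_id [simp]: "x \<in> K \<Longrightarrow> conj 1 1 x = x"
  by (elim KE) (simp add: conj_quad)

lemma conj_eq_0_iff: "x \<in> K \<Longrightarrow> e \<in> signs \<Longrightarrow> f \<in> signs \<Longrightarrow> conj e f x = 0 \<longleftrightarrow> x = 0"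
  using conj_conj[of x e f e f] by auto

lemma conj_prod: "finite A \<Longrightarrow> (\<And>i. i \<in> A \<Longrightarrow> g i \<in> K) \<Longrightarrow> e \<in> signs \<Longrightarrow> f \<in> signs \<Longrightarrow>
   prod g A \<in> K \<and> conj e f (prod g A) = (\<Prod>i\<in>A. conj e f (g i))"
  by (induction A rule: finite_induct) (auto simp: conj_mult)

lemma K_power [simp, intro]: "x \<in> K \<Longrightarrow> x ^ n \<in> K"
  by (induction n) auto

lemma conj_power: "x \<in> K \<Longrightarrow> e \<in> signs \<Longrightarrow> f \<in> signs \<Longrightarrow> conj e f (x ^ n) = conj e f x ^ n"
  by (induction n) (auto simp: conj_mult)

text \<open>The two maps generate the Galois group; invariance under both forces the coordinates of
  \<open>s1\<close>, \<open>s2\<close> and \<open>s1 * s2\<close> to equal their negatives.\<close>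

lemma fixed_rat:
  assumes "x \<in> K" "conj (-1) 1 x = x" "conj 1 (-1) x = x"
  shows "x \<in> \<rat>"
proof -
  obtain a b c d where x: "x = quad s1 s2 (a,b,c,d)" using assms(1) by (metis KE prod_cases4)
  have "quad s1 s2 (a,-b,c,-d) = quad s1 s2 (a,b,c,d)" "quad s1 s2 (a,b,-c,-d) = quad s1 s2 (a,b,c,d)"
    using assms(2,3) unfolding x by (simp_all add: conj_quad' del: quad.simps)
  hence "-b = b" "-c = c" "-d = d" by (simp_all add: inj_eq[OF inj_quad] del: quad.simps)
  hence "b = 0" "c = 0" "d = 0" by auto
  thus ?thesis by (simp add: x)
qed

definition Nm :: "real \<Rightarrow> real" where
  "Nm x = x * conj (-1) 1 x * (conj 1 (-1) x * conj (-1) (-1) x)"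

lemma Nm_rat: "x \<in> K \<Longrightarrow> Nm x \<in> \<rat>"
  by (rule fixed_rat) (auto simp: Nm_def conj_mult conj_conj K_mult)

lemma Nm_eq_0_iff: "x \<in> K \<Longrightarrow> Nm x = 0 \<longleftrightarrow> x = 0"
  by (auto simp: Nm_def conj_eq_0_iff)

lemma Nm_mult: "x \<in> K \<Longrightarrow> y \<in> K \<Longrightarrow> Nm (x * y) = Nm x * Nm y"
  by (simp add: Nm_def conj_mult)

lemma K_inverse [simp, intro]: assumes "x \<in> K" shows "inverse x \<in> K"
proof (cases "x = 0")
  case False
  \<comment> \<open>The product of the other three conjugates, so that \<open>x * y\<close> is the
    norm, a nonzero rational.\<close>
  define y where "y = conj (-1) 1 x * (conj 1 (-1) x * conj (-1) (-1) x)"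
  have y: "y \<in> K" using assms by (auto simp: y_def)
  have "Nm x = x * y" by (simp add: Nm_def y_def)
  hence "inverse x = inverse (Nm x) * y" using Nm_eq_0_iff[OF assms] False by (simp add: field_simps)
  moreover have "inverse (Nm x) \<in> K" using Nm_rat[OF assms] by (auto intro!: K_rat)
  ultimately show ?thesis using y by simp
qed auto

lemma K_divide [simp, intro]: "x \<in> K \<Longrightarrow> y \<in> K \<Longrightarrow> x / y \<in> K"
  by (simp add: divide_inverse K_mult K_inverse)

lemma conj_inverse: "x \<in> K \<Longrightarrow> e \<in> signs \<Longrightarrow> f \<in> signs \<Longrightarrow> conj e f (inverse x) = inverse (conj e f x)"
  using conj_mult[of x "inverse x" e f] K_inverse[of x] 
  by (cases "x = 0") (auto simp: inverse_eq_divide eq_divide_eq conj_eq_0_iff mult.commute)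

lemma s_in_K: "s1 \<in> K" "s2 \<in> K"
  using quad_in_K[of "(0,1,0,0)"] quad_in_K[of "(0,0,1,0)"] by simp_all

lemma conj_poly:
  assumes "x \<in> K" "e \<in> signs" "f \<in> signs"
  shows "poly (map_poly of_int p) x \<in> K \<and>
         conj e f (poly (map_poly of_int p) x) = poly (map_poly of_int p) (conj e f x)"
  by (induction p) (use assms in \<open>auto simp: map_poly_pCons conj_add conj_mult\<close>)

lemma algebraic_int_conj:
  assumes "x \<in> K" "algebraic_int x" "e \<in> signs" "f \<in> signs"
  shows "algebraic_int (conj e f x)"
proof -
  obtain p where p: "poly (map_poly of_int p) x = 0" "lead_coeff p = 1"
    using assms(2) unfolding algebraic_int_altdef_ipoly by auto
  hence "poly (map_poly of_int p) (conj e f x) = 0"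
    using conj_poly[OF assms(1,3,4), of p] by simp
  thus ?thesis using p(2) unfolding algebraic_int_altdef_ipoly by auto
qed

lemma K_eq_generate_field: "generate_field ring_of_type_algebra {s1, s2} = K"
proof (intro equalityI subsetI)
  fix x assume "x \<in> generate_field ring_of_type_algebra {s1, s2}"
  thus "x \<in> K"
  proof (induction rule: generate_field.induct)
    case (a_inv h)
    interpret R: ring "ring_of_type_algebra :: real ring" ..
    have "\<ominus>\<^bsub>ring_of_type_algebra\<^esub> h = - h"
      by (rule R.minus_equality) (auto simp: ring_of_type_algebra_def)
    thus ?case using a_inv by auto
  next
    case (m_inv h)
    interpret R: cring "ring_of_type_algebra :: real ring" ..
    have "inv\<^bsub>ring_of_type_algebra\<^esub> h = inverse h"
      by (rule R.comm_inv_char) (use m_inv in \<open>auto simp: ring_of_type_algebra_def\<close>)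
    thus ?case using m_inv by auto
  qed (auto simp: ring_of_type_algebra_def s_in_K)
next
  fix x assume "x \<in> K"
  let ?G = "generate_field ring_of_type_algebra {s1, s2}"
  interpret F: Ring.field "ring_of_type_algebra :: real ring" ..
  have G: "a + b \<in> ?G" "a * b \<in> ?G" if "a \<in> ?G" "b \<in> ?G" for a b
    using generate_field.eng_add[OF that] generate_field.eng_mult[OF that] by (auto simp: ring_of_type_algebra_def)
  have G1: "1 \<in> ?G" using generate_field.one[of "ring_of_type_algebra :: real ring"] by (simp add: ring_of_type_algebra_def)
  have Gm: "- a \<in> ?G" if "a \<in> ?G" for a
  proof -
    have "\<ominus>\<^bsub>ring_of_type_algebra\<^esub> a = - a"
      by (rule F.minus_equality) (auto simp: ring_of_type_algebra_def)
    thus ?thesis using generate_field.a_inv[OF that] by simp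
  qed
  have Gi: "inverse a \<in> ?G" if "a \<in> ?G" "a \<noteq> 0" for a
  proof -
    have "inv\<^bsub>ring_of_type_algebra\<^esub> a = inverse a"
      by (rule F.comm_inv_char) (use that in \<open>auto simp: ring_of_type_algebra_def\<close>)
    thus ?thesis using generate_field.m_inv[OF that(1)] that(2) by (simp add: ring_of_type_algebra_def)
  qed
  have G0: "0 \<in> ?G" using G(1)[OF G1 Gm[OF G1]] by simp
  have Gn: "of_nat n \<in> ?G" for n by (induction n) (auto simp: G0 G1 intro: G)
  have Gz: "of_int k \<in> ?G" for k by (cases k) (auto intro: Gn Gm simp del: of_nat_Suc)
  have Gr: "of_rat r \<in> ?G" for r
  proof -
    obtain a b where r: "quotient_of r = (a, b)" by fastforce
    have "b > 0" "r = of_int a / of_int b"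
      using quotient_of_denom_pos[OF r] quotient_of_div[OF r] by auto
    hence "of_rat r = of_int a * inverse (of_int b :: real)"
      by (simp add: of_rat_mult of_rat_inverse divide_inverse)
    thus ?thesis using Gz[of a] G(2) Gi[OF Gz[of b]] \<open>b > 0\<close> by simp
  qed
  have "s1 \<in> ?G" "s2 \<in> ?G" by (auto intro: generate_field.incl)
  moreover obtain a b c d where x: "x = quad s1 s2 (a,b,c,d)" using \<open>x \<in> K\<close> by (metis KE prod_cases4)
  ultimately show "x \<in> ?G" by (auto intro!: G Gr)
qed

section \<open>The ring of integers\<close>

definition OK :: "real set" where "OK = {x \<in> K. algebraic_int x}"

abbreviation R :: "real ring" where "R \<equiv> ring_of_integers K"

lemma R_simps [simp]: "carrier R = OK" "x \<otimes>\<^bsub>R\<^esub> y = x * y" "x \<oplus>\<^bsub>R\<^esub> y = x + y" "\<one>\<^bsub>R\<^esub> = 1" "\<zero>\<^bsub>R\<^esub> = 0"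
  by (simp_all add: ring_of_integers_def ring_of_type_algebra_def OK_def)

lemma OK_K [dest]: "x \<in> OK \<Longrightarrow> x \<in> K" by (simp add: OK_def)

lemma OK_add [simp, intro]: "x \<in> OK \<Longrightarrow> y \<in> OK \<Longrightarrow> x + y \<in> OK"
  and OK_mult [simp, intro]: "x \<in> OK \<Longrightarrow> y \<in> OK \<Longrightarrow> x * y \<in> OK"
  by (auto simp: OK_def intro: algebraic_int_add_mult)

lemma OK_minus [simp, intro]: "x \<in> OK \<Longrightarrow> - x \<in> OK"
  by (auto simp: OK_def)

lemma OK_consts [simp]: "1 \<in> OK" "0 \<in> OK" "of_int k \<in> OK" "of_nat n \<in> OK"
  by (simp_all add: OK_def)

lemma OK_power [simp, intro]: "x \<in> OK \<Longrightarrow> x ^ n \<in> OK"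
  by (induction n) auto

lemma OK_conj [simp, intro]: "x \<in> OK \<Longrightarrow> e \<in> signs \<Longrightarrow> f \<in> signs \<Longrightarrow> conj e f x \<in> OK"
  by (auto simp: OK_def intro: algebraic_int_conj)

lemma OK_rat: "x \<in> OK \<Longrightarrow> x \<in> \<rat> \<Longrightarrow> x \<in> \<int>"
  by (auto simp: OK_def intro: rational_algebraic_int_is_int)

lemma s_in_OK: "s1 \<in> OK" "s2 \<in> OK"
proof -
  have "algebraic_int s" if "s\<^sup>2 = real n" for s n
    using algebraic_int_root[of "real n" "monom 1 2" s] that by (simp add: poly_monom degree_monom_eq)
  thus "s1 \<in> OK" "s2 \<in> OK" using s1 s2 s_in_K by (auto simp: OK_def)
qed

lemma cring_R: "cring R"
proof -
  interpret T: cring "ring_of_type_algebra :: real ring" ..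
  have m: "\<ominus>\<^bsub>ring_of_type_algebra\<^esub> h = - h" for h :: real
    by (rule T.minus_equality) (auto simp: ring_of_type_algebra_def)
  have "subring OK ring_of_type_algebra"
    by (rule T.subringI) (simp_all add: m)
  hence "subcring OK ring_of_type_algebra" by (rule T.subcringI')
  moreover have "OK \<subseteq> carrier ring_of_type_algebra" by (simp add: ring_of_type_algebra_def)
  ultimately show ?thesis using T.subcring_iff unfolding ring_of_integers_def OK_def by blast
qed

interpretation R: cring R by (rule cring_R)

lemma R_a_inv [simp]: "x \<in> OK \<Longrightarrow> \<ominus>\<^bsub>R\<^esub> x = - x"
  by (rule R.minus_equality) auto

lemma idealI':
  assumes "I \<subseteq> OK" "0 \<in> I" "\<And>x y. x \<in> I \<Longrightarrow> y \<in> I \<Longrightarrow> x + y \<in> I"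
    "\<And>a x. a \<in> OK \<Longrightarrow> x \<in> I \<Longrightarrow> a * x \<in> I"
  shows "ideal I R"
proof (rule idealI)
  show "ring R" by (rule R.ring_axioms)
  show "subgroup I (add_monoid R)"
  proof (rule R.add.subgroupI)
    fix a assume "a \<in> I"
    moreover have "- a = -1 * a" by simp
    moreover have "-1 \<in> OK" using OK_minus[of 1] by simp
    ultimately show "\<ominus>\<^bsub>R\<^esub> a \<in> I" using assms(4)[of "-1" a] assms(1) by auto
  qed (use assms in auto)
  fix a x assume ax: "a \<in> I" "x \<in> carrier R"
  thus "x \<otimes>\<^bsub>R\<^esub> a \<in> I" using assms(4) by simp
  thus "a \<otimes>\<^bsub>R\<^esub> x \<in> I" by (simp add: mult.commute)
qed

lemma idealD:
  assumes "ideal I R"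
  shows "I \<subseteq> OK" "0 \<in> I" "\<And>x y. x \<in> I \<Longrightarrow> y \<in> I \<Longrightarrow> x + y \<in> I"
    "\<And>a x. a \<in> OK \<Longrightarrow> x \<in> I \<Longrightarrow> a * x \<in> I" "\<And>x y. x \<in> I \<Longrightarrow> y \<in> I \<Longrightarrow> x - y \<in> I"
    "1 \<in> I \<Longrightarrow> I = OK"
proof -
  interpret I: ideal I R by fact
  show 1: "I \<subseteq> OK" using I.a_subset by simp
  show "0 \<in> I" using I.zero_closed by simp
  show "x + y \<in> I" if "x \<in> I" "y \<in> I" for x y using I.a_closed[OF that] by simp
  show 2: "a * x \<in> I" if "a \<in> OK" "x \<in> I" for a x using I.I_l_closed[of x a] that by simp
  show "x - y \<in> I" if "x \<in> I" "y \<in> I" for x y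
    using I.a_closed[of x "-1 * y"] 2[of "-1" y] OK_minus[of 1] that by simp
  show "1 \<in> I \<Longrightarrow> I = OK" using I.one_imp_carrier by simp
qed

lemma maximal_not_one: "maximalideal I R \<Longrightarrow> 1 \<notin> I"
  using idealD(6)[of I] maximalideal.I_notcarr[of I R] by (auto simp: maximalideal_def)

lemma maximal_prime: "maximalideal I R \<Longrightarrow> a \<in> OK \<Longrightarrow> b \<in> OK \<Longrightarrow> a * b \<in> I \<Longrightarrow> a \<in> I \<or> b \<in> I"
  using primeideal.I_prime[OF R.maximalideal_prime, of I a b] by simp

lemma maximal_ideal: "maximalideal I R \<Longrightarrow> ideal I R" by (simp add: maximalideal_def)

definition principal :: "real \<Rightarrow> real set" where "principal a = (\<lambda>w. a * w) ` OK"

lemma cgenideal_eq: "PIdl\<^bsub>R\<^esub> a = principal a"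
  by (auto simp: cgenideal_def principal_def image_def mult.commute)

text \<open>Ramification enters only through a nilpotent element of the ring of integers modulo \<open>p\<close>.\<close>

lemma ramified_witness:
  assumes "ramified_prime K p"
  obtains P x where "maximalideal P R" "of_nat p \<in> P" "x \<in> OK" "x \<notin> principal (of_nat p)"
    "x * x \<in> principal (of_nat p)"
proof -
  from assms obtain P J e where p: "Factorial_Ring.prime p" and P: "maximalideal P R" and J: "ideal J R"
    and e: "2 \<le> (e::nat)" 
    and eq: "PIdl\<^bsub>R\<^esub> (of_nat p) = (P [^]\<^bsub>ideals_set R\<^esub> e) \<otimes>\<^bsub>ideals_set R\<^esub> J"
    unfolding ramified_prime_def by blast
  interpret S: comm_monoid "ideals_set R" by (rule R.ideals_set_is_comm_monoid)
  have carr: "I \<in> carrier (ideals_set R) \<longleftrightarrow> ideal I R" for I by (simp add: ideals_set_def)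
  have mult: "I \<otimes>\<^bsub>ideals_set R\<^esub> L = ideal_prod R I L" for I L by (simp add: ideals_set_def)
  have PJ: "P \<in> carrier (ideals_set R)" "J \<in> carrier (ideals_set R)"
    using P J by (auto simp: carr maximalideal_def)
  obtain k where k: "e = Suc (Suc k)" using e by (metis add_2_eq_Suc le_Suc_ex)
  \<comment> \<open>This is P^(e-1) J, so I P = (p), and e >= 2 gives I \<subseteq> P. Every x in I
    then has its square in I P.\<close>
  define I where "I = (P [^]\<^bsub>ideals_set R\<^esub> Suc k) \<otimes>\<^bsub>ideals_set R\<^esub> J"
  have I: "I \<in> carrier (ideals_set R)" using PJ by (simp add: I_def)
  hence idI: "ideal I R" by (simp add: carr)
  have IP: "ideal_prod R I P = principal (of_nat p)"
    unfolding mult[symmetric] cgenideal_eq[symmetric] eq I_def k using PJ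
    by (simp add: S.m_ac)
  have "I = ideal_prod R P ((P [^]\<^bsub>ideals_set R\<^esub> k) \<otimes>\<^bsub>ideals_set R\<^esub> J)"
    unfolding mult[symmetric] I_def using PJ by (simp add: S.m_ac)
  moreover have "ideal ((P [^]\<^bsub>ideals_set R\<^esub> k) \<otimes>\<^bsub>ideals_set R\<^esub> J) R"
    using PJ by (auto simp: carr[symmetric])
  ultimately have "I \<subseteq> P" using R.ideal_prod_inter[OF maximal_ideal[OF P]] by blast
  have sub: "principal (of_nat p) \<subseteq> I" "principal (of_nat p) \<subseteq> P"
    using R.ideal_prod_inter[OF idI maximal_ideal[OF P]] IP by auto
  have pp: "of_nat p \<in> principal (of_nat p)" by (auto simp: principal_def intro!: image_eqI[of _ _ 1])
  \<comment> \<open>Otherwise (p) P = (p), and cancelling \<open>p\<close> would put 1 into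
    \<open>P\<close>.\<close>
  have "I \<noteq> principal (of_nat p)"
  proof
    assume I: "I = principal (of_nat p)"
    have "\<exists>w\<in>P. y = of_nat p * w" if "y \<in> ideal_prod R I P" for y
      using that
    proof (induction rule: ideal_prod.induct)
      case (prod i j)
      then obtain w where "w \<in> OK" "i = of_nat p * w" by (auto simp: I principal_def)
      thus ?case using prod idealD(4)[OF maximal_ideal[OF P]] by auto
    next
      case (sum y z)
      thus ?case using idealD(3)[OF maximal_ideal[OF P]] by (auto simp: distrib_left[symmetric])
    qed
    from this[of "of_nat p"] pp IP obtain w where "w \<in> P" "of_nat p = of_nat p * (w::real)" by auto
    hence "1 \<in> P" using prime_gt_0_nat[OF p] by auto
    thus False using maximal_not_one[OF P] by simp
  qed
  then obtain x where x: "x \<in> I" "x \<notin> principal (of_nat p)" using sub by auto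
  have "x * x \<in> ideal_prod R I P" using ideal_prod.prod[of x I x P R] x \<open>I \<subseteq> P\<close> by auto
  hence "x * x \<in> principal (of_nat p)" by (simp add: IP)
  thus ?thesis using that[OF P _ _ x(2)] pp sub x(1) idealD(1)[OF idI] by blast
qed

section \<open>Traces and residue classes modulo a rational integer\<close>

definition trace :: "real \<Rightarrow> real" where
  "trace x = x + conj (-1) 1 x + conj 1 (-1) x + conj (-1) (-1) x"

lemma trace_int: "x \<in> OK \<Longrightarrow> trace x \<in> \<int>"
proof -
  assume x: "x \<in> OK"
  have "trace x \<in> \<rat>"
    by (rule fixed_rat) (use x in \<open>auto simp: trace_def conj_add conj_conj dest!: OK_K\<close>)
  moreover have "trace x \<in> OK" using x by (auto simp: trace_def)
  ultimately show ?thesis by (rule OK_rat[rotated])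
qed

lemma trace_diff: "x \<in> K \<Longrightarrow> y \<in> K \<Longrightarrow> trace (x - y) = trace x - trace y"
proof -
  assume xy: "x \<in> K" "y \<in> K"
  hence "conj e f (x - y) = conj e f x - conj e f y" if "e \<in> signs" "f \<in> signs" for e f
    using conj_add[of "x - y" y e f] by auto
  thus ?thesis by (simp add: trace_def)
qed

lemma trace_quad: "trace (quad s1 s2 (a,b,c,d)) = 4 * of_rat a"
  by (simp add: trace_def conj_quad' of_rat_minus del: quad.simps) (simp add: of_rat_minus)

lemma D_pos: "D1 > 0" "D2 > 0"
  using s1 s2 irrational by (auto intro!: gr0I)

text \<open>For coordinates a, b, c, d of \<open>x\<close> the four traces are 4a, 4bD1, 4cD2 and
  4dD1D2. Divisibility by \<open>m\<close> makes each coordinate \<open>n\<close> times an integer,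
  so the quotient of \<open>x\<close> by \<open>n\<close> even lies in Z[s1, s2].\<close>

lemma congruent_if_traces:
  fixes n :: nat
  assumes x: "x \<in> K" and n: "m = 4 * of_nat D1 * of_nat D2 * of_nat n"
    and tr: "\<And>s. s \<in> {1, s1, s2, s1 * s2} \<Longrightarrow> \<exists>k::int. trace (x * s) = m * of_int k"
  shows "x \<in> principal (of_nat n)"
proof -
  obtain a b c d where q: "x = quad s1 s2 (a,b,c,d)" using x by (metis KE prod_cases4)
  have sq: "s1 * s1 = real D1" "s2 * s2 = real D2" using s1 s2 by (simp_all add: power2_eq_square)
  have 1: "s1 = quad s1 s2 (0,1,0,0)" "s2 = quad s1 s2 (0,0,1,0)" "s1 * s2 = quad s1 s2 (0,0,0,1)"
    by simp_all
  have xs: "x * s1 = quad s1 s2 (b * of_nat D1, a, d * of_nat D1, c)"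
       "x * s2 = quad s1 s2 (c * of_nat D2, d * of_nat D2, a, b)"
       "x * (s1 * s2) = quad s1 s2 (d * of_nat D1 * of_nat D2, c * of_nat D2, b * of_nat D1, a)"
    unfolding q by (subst 1, subst quad_mult[OF s1 s2], simp)+
  obtain k0 where "trace (x * 1) = m * of_int k0" using tr[of 1] by auto
  hence k0: "of_rat a = real n * of_int (int D1 * int D2 * k0)" unfolding q n by (simp only: mult_1_right trace_quad) simp
  obtain k1 where "trace (x * s1) = m * of_int k1" using tr[of s1] by auto
  hence k1: "of_rat b = real n * of_int (int D2 * k1)" unfolding xs n trace_quad using D_pos by (simp add: of_rat_mult)
  obtain k2 where "trace (x * s2) = m * of_int k2" using tr[of s2] by auto
  hence k2: "of_rat c = real n * of_int (int D1 * k2)" unfolding xs n trace_quad using D_pos by (simp add: of_rat_mult)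
  obtain k3 where "trace (x * (s1 * s2)) = m * of_int k3" using tr[of "s1 * s2"] by auto
  hence k3: "of_rat d = real n * of_int k3" unfolding xs n trace_quad using D_pos by (simp add: of_rat_mult)
  define w where "w = of_int (int D1 * int D2 * k0) + of_int (int D2 * k1) * s1 + of_int (int D1 * k2) * s2 + of_int k3 * (s1 * s2)"
  have "x = of_nat n * w" unfolding q w_def quad.simps k0 k1 k2 k3 by (simp only: distrib_left mult.assoc)
  moreover have "w \<in> OK" unfolding w_def by (intro OK_add OK_mult OK_consts s_in_OK)
  ultimately show ?thesis by (auto simp: principal_def)
qed

text \<open>Up to the factor \<open>4 D1 D2\<close>, the traces against \<open>1, s1, s2, s1 s2\<close> are integral coordinates, so reducing
  them modulo \<open>4 D1 D2 n\<close> separates the classes modulo \<open>n\<close>.\<close>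

definition residue :: "nat \<Rightarrow> real \<Rightarrow> int \<times> int \<times> int \<times> int" where
  "residue n x = (let m = 4 * int D1 * int D2 * int n in
     (\<lfloor>trace x\<rfloor> mod m, \<lfloor>trace (x * s1)\<rfloor> mod m, \<lfloor>trace (x * s2)\<rfloor> mod m, \<lfloor>trace (x * (s1 * s2))\<rfloor> mod m))"

lemma finite_range_residue: assumes "n > 0" shows "finite (range (residue n))"
proof -
  define m where "m = 4 * int D1 * int D2 * int n"
  have "m > 0" using D_pos assms by (simp add: m_def)
  hence "residue n x \<in> {0..<m} \<times> {0..<m} \<times> {0..<m} \<times> {0..<m}" for x
    unfolding residue_def Let_def m_def[symmetric] by simp
  hence "range (residue n) \<subseteq> {0..<m} \<times> {0..<m} \<times> {0..<m} \<times> {0..<m}" by blast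
  thus ?thesis by (rule finite_subset) simp
qed

lemma residue_eq_imp:
  assumes "x \<in> OK" "y \<in> OK" "residue n x = residue n y"
  shows "x - y \<in> principal (of_nat n)"
proof (rule congruent_if_traces[OF _ refl])
  fix s assume s: "s \<in> {1, s1, s2, s1 * s2}"
  hence "s \<in> OK" using s_in_OK by auto
  define m where "m = 4 * int D1 * int D2 * int n"
  have "trace (x * s) \<in> \<int>" "trace (y * s) \<in> \<int>" using assms \<open>s \<in> OK\<close> by (auto intro: trace_int)
  moreover have "\<lfloor>trace (x * s)\<rfloor> mod m = \<lfloor>trace (y * s)\<rfloor> mod m"
    using assms(3) s unfolding residue_def Let_def m_def[symmetric] by auto
  then obtain k where "\<lfloor>trace (x * s)\<rfloor> - \<lfloor>trace (y * s)\<rfloor> = m * k" 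
    by (metis mod_eq_dvd_iff dvdE)
  hence "of_int \<lfloor>trace (x * s)\<rfloor> - of_int \<lfloor>trace (y * s)\<rfloor> = (of_int (m * k) :: real)"
    by (metis of_int_diff)
  ultimately have "trace (x * s) - trace (y * s) = of_int m * of_int k"
    by (auto elim!: Ints_cases)
  moreover have "trace ((x - y) * s) = trace (x * s) - trace (y * s)"
    using assms \<open>s \<in> OK\<close> by (subst trace_diff[symmetric]) (auto simp: left_diff_distrib)
  ultimately show "\<exists>k. trace ((x - y) * s) = 4 * real D1 * real D2 * real n * of_int k"
    by (intro exI[of _ k]) (simp add: m_def)
qed (use assms in auto)

section \<open>Finite quotients and maximal ideals over a prime\<close>

lemma a_r_coset_eq: "I +>\<^bsub>R\<^esub> x = (\<lambda>i. i + x) ` I"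
  by (auto simp: a_r_coset_def')

lemma carrier_Quot: "carrier (R Quot I) = (\<lambda>x. (\<lambda>i. i + x) ` I) ` OK"
  by (auto simp: FactRing_def A_RCOSETS_def' a_r_coset_eq)

lemma Quot_ops: "\<zero>\<^bsub>R Quot I\<^esub> = I" "\<And>a b. a \<oplus>\<^bsub>R Quot I\<^esub> b = a <+>\<^bsub>R\<^esub> b"
  by (simp_all add: FactRing_def)

lemma coset_eq_iff:
  assumes "ideal I R" "x \<in> OK" "y \<in> OK"
  shows "(\<lambda>i. i + x) ` I = (\<lambda>i. i + y) ` I \<longleftrightarrow> x - y \<in> I"
proof
  assume eq: "(\<lambda>i. i + x) ` I = (\<lambda>i. i + y) ` I"
  have "x \<in> (\<lambda>i. i + x) ` I" using idealD(2)[OF assms(1)] by (auto intro!: image_eqI[of _ _ 0])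
  thus "x - y \<in> I" using eq by auto
next
  have sub: "(\<lambda>i. i + x) ` I \<subseteq> (\<lambda>i. i + y) ` I" if xy: "x - y \<in> I" for x y
  proof
    fix z assume "z \<in> (\<lambda>i. i + x) ` I"
    then obtain i where i: "i \<in> I" "z = i + x" by auto
    have "i + (x - y) \<in> I" using idealD(3)[OF assms(1) i(1) xy] .
    thus "z \<in> (\<lambda>i. i + y) ` I" using i by (intro image_eqI[of _ _ "i + (x - y)"]) auto
  qed
  assume xy: "x - y \<in> I"
  moreover have "y - x \<in> I" using idealD(5)[OF assms(1) idealD(2)[OF assms(1)] xy] by simp
  ultimately show "(\<lambda>i. i + x) ` I = (\<lambda>i. i + y) ` I" using sub by blast
qed

lemma principal_subset_iff: "ideal I R \<Longrightarrow> principal a \<subseteq> I \<longleftrightarrow> a \<in> I"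
proof
  assume "ideal I R" "a \<in> I"
  thus "principal a \<subseteq> I" using idealD(4)[of I _ a] by (auto simp: principal_def mult.commute)
next
  assume "principal a \<subseteq> I"
  moreover have "a \<in> principal a" unfolding principal_def by (intro image_eqI[of _ _ 1]) auto
  ultimately show "a \<in> I" by blast
qed

lemma finite_Quot:
  assumes "ideal I R" "of_nat n \<in> I" "n > 0"
  shows "finite (carrier (R Quot I))"
proof -
  \<comment> \<open>As \<open>n\<close> lies in \<open>I\<close>, the coset of \<open>x\<close>
    depends only on \<open>residue n x\<close>; \<open>SOME\<close> picks a representative of each
    residue.\<close>
  define g where "g = (\<lambda>r. (\<lambda>i. i + (SOME x. x \<in> OK \<and> residue n x = r)) ` I)"
  have "(\<lambda>i. i + x) ` I = g (residue n x)" if x: "x \<in> OK" for x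
  proof -
    define y where "y = (SOME y. y \<in> OK \<and> residue n y = residue n x)"
    have y: "y \<in> OK" "residue n y = residue n x"
      unfolding y_def by (rule someI2[of _ x], use x in simp, simp)+
    hence "x - y \<in> I" using residue_eq_imp[OF x y(1) y(2)[symmetric]] principal_subset_iff[OF assms(1), of "of_nat n"] assms(2) by auto
    thus ?thesis using coset_eq_iff[OF assms(1) x y(1)] by (simp add: g_def y_def)
  qed
  hence "carrier (R Quot I) \<subseteq> g ` range (residue n)" unfolding carrier_Quot by auto
  thus ?thesis using finite_range_residue[OF assms(3)] by (auto intro: finite_subset)
qed

text \<open>An ideal containing \<open>n\<close> is a union of classes modulo \<open>n\<close>, so
  its image under \<open>residue n\<close> determines it.\<close>

lemma finite_ideals_containing:
  assumes "n > 0"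
  shows "finite {I. ideal I R \<and> of_nat n \<in> I}"
proof (rule inj_on_finite)
  show "(\<lambda>I. residue n ` I) ` {I. ideal I R \<and> of_nat n \<in> I} \<subseteq> Pow (range (residue n))" by auto
  show "finite (Pow (range (residue n)))" using finite_range_residue[OF assms] by simp
  have "I \<subseteq> J" if IJ: "ideal I R" "ideal J R" "of_nat n \<in> J" "residue n ` I = residue n ` J" for I J
  proof
    fix x assume x: "x \<in> I"
    then obtain y where y: "y \<in> J" "residue n x = residue n y" using IJ(4) by blast
    have "x \<in> OK" "y \<in> OK" using x y idealD(1)[OF IJ(1)] idealD(1)[OF IJ(2)] by auto
    hence "x - y \<in> J" using residue_eq_imp[of x y n] y principal_subset_iff[OF IJ(2), of "of_nat n"] IJ(3) by auto
    thus "x \<in> J" using idealD(3)[OF IJ(2) _ y(1), of "x - y"] by simp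
  qed
  thus "inj_on (\<lambda>I. residue n ` I) {I. ideal I R \<and> of_nat n \<in> I}"
    unfolding inj_on_def by blast
qed

text \<open>Lagrange's theorem for the class of 1 in the additive group of the quotient.\<close>

lemma card_Quot_in_ideal:
  assumes I: "ideal I R" and fin: "finite (carrier (R Quot I))"
  shows "of_nat (card (carrier (R Quot I))) \<in> I"
proof -
  interpret I: ideal I R by fact
  interpret Q: cring "R Quot I" by (rule I.quotient_is_cring[OF cring_R])
  have c: "I +>\<^bsub>R\<^esub> 1 \<in> carrier (R Quot I)" by (auto simp: carrier_Quot a_r_coset_eq)
  have "(I +>\<^bsub>R\<^esub> 1) [^]\<^bsub>add_monoid (R Quot I)\<^esub> k = I +>\<^bsub>R\<^esub> of_nat k" for k :: nat
  proof (induction k)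
    case 0
    show ?case by (simp add: Quot_ops a_r_coset_eq)
  next
    case (Suc k)
    thus ?case using I.a_rcos_sum[of "of_nat k" 1] by (simp add: Quot_ops add.commute)
  qed
  moreover have "(I +>\<^bsub>R\<^esub> 1) [^]\<^bsub>add_monoid (R Quot I)\<^esub> card (carrier (R Quot I)) = \<zero>\<^bsub>R Quot I\<^esub>"
    using Q.add.pow_order_eq_1[OF _ ] c fin by (simp add: Coset.order_def add_pow_def)
  ultimately have "I +>\<^bsub>R\<^esub> of_nat (card (carrier (R Quot I))) = I" by (simp add: Quot_ops)
  hence "(\<lambda>i. i + of_nat (card (carrier (R Quot I)))) ` I = (\<lambda>i. i + 0) ` I" by (simp add: a_r_coset_eq)
  thus ?thesis using coset_eq_iff[OF I, of "of_nat (card (carrier (R Quot I)))" 0] by simp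
qed

text \<open>A subgroup of order \<open>r\<close> in the additive group of the residue field is
  killed by \<open>r\<close> and by \<open>p\<close>, hence trivial if the two primes differ. So the
  norm of a maximal ideal over \<open>p\<close> is a power of \<open>p\<close>.\<close>

lemma prime_dvd_card_Quot:
  assumes P: "maximalideal P R" and p: "Factorial_Ring.prime p" "of_nat p \<in> P"
    and r: "Factorial_Ring.prime r" "r dvd card (carrier (R Quot P))"
  shows "r = p"
proof (rule ccontr)
  assume neq: "r \<noteq> p"
  have idP: "ideal P R" using maximal_ideal[OF P] .
  interpret P: ideal P R by fact
  interpret Q: cring "R Quot P" by (rule P.quotient_is_cring[OF cring_R])
  have fin: "finite (carrier (R Quot P))" using finite_Quot[OF idP p(2)] prime_gt_0_nat[OF p(1)] .
  \<comment> \<open>The exponent 1 is written out so that Sylow's theorem yields a subgroup of order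
    exactly \<open>r\<close>.\<close>
  obtain m where m: "card (carrier (R Quot P)) = r ^ 1 * m" using r(2) by (auto simp: dvd_def)
  hence "Coset.order (add_monoid (R Quot P)) = r ^ 1 * m"
    by (simp only: Coset.order_def partial_object.simps)
  then obtain H where H: "subgroup H (add_monoid (R Quot P))" "card H = r ^ 1"
    using sylow_thm[OF r(1) Q.add.is_group] fin by (metis partial_object.simps(1))
  have finH: "finite H" using H(1) fin subgroup.subset[OF H(1)] by (auto intro: finite_subset)
  interpret H: group "(add_monoid (R Quot P))\<lparr>carrier := H\<rparr>"
    by (rule Q.add.subgroup_imp_group[OF H(1)])
  have "h = P" if h: "h \<in> H" for h
  proof -
    have "h \<in> carrier (R Quot P)" using h subgroup.subset[OF H(1)] by auto
    then obtain x where x: "x \<in> OK" "h = P +>\<^bsub>R\<^esub> x" by (auto simp: carrier_Quot a_r_coset_eq)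
    have pw: "(P +>\<^bsub>R\<^esub> x) [^]\<^bsub>add_monoid (R Quot P)\<^esub> k = P +>\<^bsub>R\<^esub> (of_nat k * x)" for k :: nat
    proof (induction k)
      case 0
      show ?case by (simp add: Quot_ops a_r_coset_eq)
    next
      case (Suc k)
      thus ?case using P.a_rcos_sum[of "of_nat k * x" x] x by (simp add: Quot_ops algebra_simps)
    qed
    have "h [^]\<^bsub>(add_monoid (R Quot P))\<lparr>carrier := H\<rparr>\<^esub> r = \<one>\<^bsub>add_monoid (R Quot P)\<^esub>"
      using H.pow_order_eq_1[of h] h H(2) by (simp add: Coset.order_def)
    hence "h [^]\<^bsub>add_monoid (R Quot P)\<^esub> r = \<zero>\<^bsub>R Quot P\<^esub>"
      by (simp add: Group.nat_pow_def)
    hence "P +>\<^bsub>R\<^esub> (of_nat r * x) = P" unfolding x(2) pw by (simp add: Quot_ops)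
    hence "(\<lambda>i. i + of_nat r * x) ` P = (\<lambda>i. i + 0) ` P" by (simp add: a_r_coset_eq)
    hence rx: "of_nat r * x \<in> P" using coset_eq_iff[OF idP, of "of_nat r * x" 0] x by simp
    have px: "of_nat p * x \<in> P" using idealD(4)[OF idP x(1) p(2)] by (simp add: mult.commute)
    have "Rings.coprime (int r) (int p)" using primes_coprime[OF r(1) p(1) neq] by simp
    then obtain u v where "u * int r + v * int p = 1" by (metis coprime_iff_gcd_eq_1 bezout_int)
    hence "of_int (u * int r + v * int p) = (1 :: real)" by simp
    hence "x = of_int u * (of_nat r * x) + of_int v * (of_nat p * x)"
      by (simp add: algebra_simps) (metis distrib_right mult.assoc mult.commute mult_1)
    moreover have "\<dots> \<in> P" by (intro idealD(3)[OF idP] idealD(4)[OF idP] rx px) auto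
    ultimately have "x \<in> P" by simp
    hence "(\<lambda>i. i + x) ` P = (\<lambda>i. i + 0) ` P" using coset_eq_iff[OF idP, of x 0] x by simp
    thus ?thesis by (simp add: x(2) a_r_coset_eq)
  qed
  hence "card H \<le> card {P}" by (intro card_mono) auto
  thus False using H(2) prime_gt_1_nat[OF r(1)] by simp
qed

lemma prime_in_maximal:
  assumes m: "maximalideal m R" and n: "n > 0" "of_nat n \<in> m"
  shows "\<exists>r. Factorial_Ring.prime r \<and> r dvd n \<and> of_nat r \<in> m"
  using n
proof (induction n rule: less_induct)
  case (less n)
  have "n \<noteq> 1" using less.prems maximal_not_one[OF m] by auto
  then obtain r where r: "Factorial_Ring.prime r" "r dvd n" using prime_factor_nat by blast
  then obtain k where k: "n = r * k" by auto
  hence "of_nat r * of_nat k \<in> m" using less.prems by simp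
  hence "of_nat r \<in> m \<or> of_nat k \<in> m" using maximal_prime[OF m] by simp
  thus ?case
  proof
    assume "of_nat k \<in> m"
    moreover have "k < n" "k > 0" using k less.prems prime_gt_1_nat[OF r(1)] by auto
    ultimately show ?thesis using less.IH k by (metis dvd_mult)
  qed (use r in auto)
qed


section \<open>The Galois action on ideals\<close>

lemma ideal_conj:
  assumes I: "ideal I R" and ef: "e \<in> signs" "f \<in> signs"
  shows "ideal (conj e f ` I) R"
proof (rule idealI')
  note I' = idealD[OF I]
  have K: "x \<in> K" if "x \<in> I" for x using that I'(1) by blast
  show "conj e f ` I \<subseteq> OK" using I'(1) ef by blast
  show "0 \<in> conj e f ` I" using I'(2) by (intro image_eqI[of _ _ 0]) simp_all
  show "x + y \<in> conj e f ` I" if xy: "x \<in> conj e f ` I" "y \<in> conj e f ` I" for x y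
  proof -
    obtain v w where "v \<in> I" "w \<in> I" "x = conj e f v" "y = conj e f w" using xy by blast
    thus ?thesis using I'(3) K by (intro image_eqI[of _ _ "v + w"]) (auto simp: conj_add)
  qed
  show "a * x \<in> conj e f ` I" if ax: "a \<in> OK" "x \<in> conj e f ` I" for a x
  proof -
    obtain v where v: "v \<in> I" "x = conj e f v" using ax by blast
    have "a = conj e f (conj e f a)" using ax ef by (subst conj_conj) auto
    hence "a * x = conj e f (conj e f a * v)" using v K ax ef by (subst conj_mult) auto
    moreover have "conj e f a * v \<in> I" using I'(4) ax ef v by blast
    ultimately show ?thesis by blast
  qed
qed

lemma conj_involution: "x \<in> K \<Longrightarrow> e \<in> signs \<Longrightarrow> f \<in> signs \<Longrightarrow> conj e f (conj e f x) = x"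
  by (subst conj_conj) auto

lemma conj_image_involution:
  assumes "I \<subseteq> OK" "e \<in> signs" "f \<in> signs"
  shows "conj e f ` conj e f ` I = I"
proof -
  have "(\<lambda>x. conj e f (conj e f x)) ` I = (\<lambda>x. x) ` I"
    by (rule image_cong[OF refl], rule conj_involution) (use assms in auto)
  thus ?thesis by (simp add: image_image)
qed

lemma maximalideal_conj:
  assumes I: "maximalideal I R" and ef: "e \<in> signs" "f \<in> signs"
  shows "maximalideal (conj e f ` I) R"
proof (rule maximalidealI)
  note idI = maximal_ideal[OF I]
  show "ideal (conj e f ` I) R" using ideal_conj[OF idI ef] .
  show "carrier R \<noteq> conj e f ` I"
  proof
    assume "carrier R = conj e f ` I"
    hence "1 \<in> conj e f ` I" using OK_consts(1) by simp
    then obtain x where x: "x \<in> I" "1 = conj e f x" by blast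
    hence "x = 1" using conj_involution[of x e f] idealD(1)[OF idI] ef by auto
    thus False using x maximal_not_one[OF I] by simp
  qed
  fix J assume J: "ideal J R" "conj e f ` I \<subseteq> J" "J \<subseteq> carrier R"
  have "conj e f ` conj e f ` I \<subseteq> conj e f ` J" using J(2) by blast
  hence "I \<subseteq> conj e f ` J" using conj_image_involution[OF idealD(1)[OF idI] ef] by simp
  moreover have "conj e f ` J \<subseteq> OK" using idealD(1)[OF ideal_conj[OF J(1) ef]] .
  ultimately have "conj e f ` J = I \<or> conj e f ` J = OK"
    using maximalideal.I_maximal[OF I ideal_conj[OF J(1) ef]] by simp
  moreover have "J = conj e f ` conj e f ` J" using conj_image_involution[OF idealD(1)[OF J(1)] ef] by simp
  moreover have "conj e f ` OK = OK"
  proof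
    show "conj e f ` OK \<subseteq> OK" using ef by blast
    hence "conj e f ` conj e f ` OK \<subseteq> conj e f ` OK" by blast
    thus "OK \<subseteq> conj e f ` OK" using conj_image_involution[of OK] ef by simp
  qed
  ultimately show "J = conj e f ` I \<or> J = carrier R" by auto
qed

text \<open>Together with \<open>maximalideal_conj\<close> this shows that the Galois group permutes
  the maximal ideals of a given norm, which makes their intersection stable under conjugation. The
  bijection sends a coset to its image.\<close>

lemma card_Quot_conj:
  assumes I: "ideal I R" and ef: "e \<in> signs" "f \<in> signs"
  shows "card (carrier (R Quot (conj e f ` I))) = card (carrier (R Quot I))"
proof (rule bij_betw_same_card[symmetric])
  have IK: "I \<subseteq> K" using idealD(1)[OF I] by blast
  have img: "(`) (conj e f) ((\<lambda>i. i + x) ` I) = (\<lambda>i. i + conj e f x) ` conj e f ` I" if "x \<in> OK" for x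
    unfolding image_image using that IK by (intro image_cong) (auto simp: conj_add[OF _ OK_K])
  have surj: "x \<in> conj e f ` OK" if "x \<in> OK" for x
    using conj_involution[of x e f] that ef by (intro image_eqI[of _ _ "conj e f x"]) auto
  show "bij_betw ((`) (conj e f)) (carrier (R Quot I)) (carrier (R Quot (conj e f ` I)))"
    unfolding bij_betw_def
  proof
    show "inj_on ((`) (conj e f)) (carrier (R Quot I))"
    proof (rule inj_onI)
      fix A B assume AB: "A \<in> carrier (R Quot I)" "B \<in> carrier (R Quot I)" "conj e f ` A = conj e f ` B"
      have "A \<subseteq> OK" "B \<subseteq> OK" using AB idealD(1)[OF I] by (auto simp: carrier_Quot)
      thus "A = B" using AB(3) conj_image_involution[of A] conj_image_involution[of B] ef by metis
    qed
    show "(`) (conj e f) ` carrier (R Quot I) = carrier (R Quot (conj e f ` I))"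
    proof
      show "(`) (conj e f) ` carrier (R Quot I) \<subseteq> carrier (R Quot (conj e f ` I))"
      proof
        fix A assume "A \<in> (`) (conj e f) ` carrier (R Quot I)"
        then obtain x where x: "x \<in> OK" "A = conj e f ` ((\<lambda>i. i + x) ` I)" unfolding carrier_Quot by blast
        hence "A = (\<lambda>i. i + conj e f x) ` (conj e f ` I)" using img by simp
        thus "A \<in> carrier (R Quot (conj e f ` I))"
          unfolding carrier_Quot by (rule image_eqI) (use x ef in blast)
      qed
      show "carrier (R Quot (conj e f ` I)) \<subseteq> (`) (conj e f) ` carrier (R Quot I)"
      proof
        fix A assume "A \<in> carrier (R Quot (conj e f ` I))"
        then obtain x where x: "x \<in> OK" "A = (\<lambda>i. i + x) ` conj e f ` I" by (auto simp: carrier_Quot)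
        obtain y where "y \<in> OK" "x = conj e f y" using surj[OF x(1)] by blast
        hence "A = conj e f ` ((\<lambda>i. i + y) ` I)" using img[of y] x(2) by simp
        moreover have "(\<lambda>i. i + y) ` I \<in> carrier (R Quot I)" unfolding carrier_Quot using \<open>y \<in> OK\<close> by (rule imageI)
        ultimately show "A \<in> (`) (conj e f) ` carrier (R Quot I)" by (rule image_eqI)
      qed
    qed
  qed
qed

section \<open>Ostrowski ideals as intersections\<close>

lemma comaximal:
  assumes "maximalideal I R" "maximalideal J R" "I \<noteq> J"
  shows "I <+>\<^bsub>R\<^esub> J = carrier R"
proof -
  note id = maximal_ideal[OF assms(1)] maximal_ideal[OF assms(2)]
  have add: "ideal (I <+>\<^bsub>R\<^esub> J) R" by (rule R.add_ideals[OF id])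
  have sub: "I \<subseteq> I <+>\<^bsub>R\<^esub> J" "J \<subseteq> I <+>\<^bsub>R\<^esub> J" "I <+>\<^bsub>R\<^esub> J \<subseteq> OK"
    using idealD(1,2)[OF id(1)] idealD(1,2)[OF id(2)] idealD(1)[OF add] by (force simp: set_add_def')+
  show ?thesis
  proof (rule ccontr)
    assume "\<not> ?thesis"
    hence "I <+>\<^bsub>R\<^esub> J = I" "I <+>\<^bsub>R\<^esub> J = J"
      using maximalideal.I_maximal[OF assms(1) add] maximalideal.I_maximal[OF assms(2) add] sub by auto
    thus False using assms(3) by simp
  qed
qed

text \<open>Distinct maximal ideals are comaximal, so their product is their intersection.
  Membership in an Ostrowski ideal can then be tested one maximal ideal at a time.\<close>

lemma finprod_maximal_eq_Inter:
  assumes S: "finite S" "S \<noteq> {}" "\<And>m. m \<in> S \<Longrightarrow> maximalideal m R"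
  shows "finprod (ideals_set R) (\<lambda>m. m) S = \<Inter>S"
proof -
  interpret S: comm_monoid "ideals_set R" by (rule R.ideals_set_is_comm_monoid)
  obtain h where h: "bij_betw h {0..<card S} S" using ex_bij_betw_nat_finite[OF S(1)] by blast
  obtain n where n: "card S = Suc n" using S by (metis card_gt_0_iff gr0_conv_Suc)
  have hn: "h ` {..n} = S" "inj_on h {..n}"
    using h unfolding n bij_betw_def atLeast0LessThan lessThan_Suc_atMost by auto
  have mx: "maximalideal (h i) R" if "i \<le> n" for i using S(3) hn(1) that by blast
  have carr: "S \<subseteq> carrier (ideals_set R)" using S(3) by (auto simp: ideals_set_def maximal_ideal)
  have "finprod (ideals_set R) (\<lambda>m. m) S = finprod (ideals_set R) h {..n}"
    using S.finprod_reindex[of "\<lambda>m. m" h "{..n}"] hn carr by auto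
  also have "\<dots> = (\<Inter>k\<in>{..n}. h k)"
  proof (rule R.ideal_prod_eq_Inter)
    show "h \<in> {..n} \<rightarrow> {J. ideal J R}" using mx by (auto simp: maximal_ideal)
    show "h i <+>\<^bsub>R\<^esub> h j = carrier R" if ij: "i \<in> {..n}" "j \<in> {..n}" "i \<noteq> j" for i j
    proof (rule comaximal)
      show "h i \<noteq> h j" using inj_onD[OF hn(2), of i j] ij by blast
    qed (use mx ij in auto)
  qed
  also have "\<dots> = \<Inter>S" using hn(1) by blast
  finally show ?thesis .
qed

text \<open>A maximal ideal of the same norm contains that norm, hence one of its prime divisors,
  and \<open>p\<close> is the only one. So all these ideals lie over \<open>p\<close>, and there are
  finitely many of them.\<close>

lemma ostrowski_ideal_eq_Inter:
  assumes P: "maximalideal P R" "of_nat p \<in> P" "Factorial_Ring.prime p"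
  defines "S \<equiv> {m. maximalideal m R \<and> card (carrier (R Quot m)) = card (carrier (R Quot P))}"
  shows "ostrowski_ideal K (card (carrier (R Quot P))) = \<Inter>S" "\<And>m. m \<in> S \<Longrightarrow> of_nat p \<in> m"
    "card (carrier (R Quot P)) > 0"
proof -
  note p0 = prime_gt_0_nat[OF P(3)]
  have fin: "finite (carrier (R Quot P))" using finite_Quot[OF maximal_ideal[OF P(1)] P(2) p0] .
  moreover have "carrier (R Quot P) \<noteq> {}" using OK_consts(1) unfolding carrier_Quot by blast
  ultimately show pos: "card (carrier (R Quot P)) > 0" by (simp add: card_gt_0_iff)
  show *: "of_nat p \<in> m" if m: "m \<in> S" for m
  proof -
    have m': "maximalideal m R" "card (carrier (R Quot m)) = card (carrier (R Quot P))"
      using m by (auto simp: S_def)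
    hence "finite (carrier (R Quot m))" using pos by (metis card_gt_0_iff)
    hence "of_nat (card (carrier (R Quot P))) \<in> m"
      using card_Quot_in_ideal[OF maximal_ideal[OF m'(1)]] m'(2) by simp
    then obtain r where "Factorial_Ring.prime r" "r dvd card (carrier (R Quot P))" "of_nat r \<in> m"
      using prime_in_maximal[OF m'(1) pos] by blast
    thus ?thesis using prime_dvd_card_Quot[OF P(1) P(3) P(2)] by blast
  qed
  have "S \<subseteq> {I. ideal I R \<and> of_nat p \<in> I}" using * by (auto simp: S_def maximal_ideal)
  hence "finite S" using finite_ideals_containing[OF p0] finite_subset by blast
  moreover have "P \<in> S" using P by (simp add: S_def)
  ultimately show "ostrowski_ideal K (card (carrier (R Quot P))) = \<Inter>S"
    unfolding ostrowski_ideal_def S_def[symmetric]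
    by (intro finprod_maximal_eq_Inter) (auto simp: S_def)
qed

section \<open>Generators of Ostrowski ideals\<close>

text \<open>Triviality of the class says that the coset of \<open>N\<close> is the set
  \<open>?H\<close> of principal fractional ideals. Since \<open>OK\<close> is in \<open>?H\<close>,
  the product of \<open>OK\<close> and \<open>N\<close>, which is \<open>N\<close> itself, belongs
  to this coset and is therefore principal.\<close>

lemma polya_ostrowski_principal:
  assumes polya: "polya_field K" and q: "q > 0" and I: "ideal (ostrowski_ideal K q) R"
  obtains a where "a \<in> K" "a \<noteq> 0" "ostrowski_ideal K q = principal a"
proof -
  define N where "N = ostrowski_ideal K q"
  let ?H = "principal_fractional_ideals K"
  have "ideal_class K N \<in> polya_group K"
    unfolding polya_group_def N_def by (rule generate.incl) (use q in blast)
  hence "ideal_class K N = \<one>\<^bsub>class_group K\<^esub>" using polya by (simp add: polya_field_def)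
  hence cl: "?H #>\<^bsub>fractional_ideal_group K\<^esub> N = ?H"
    by (simp add: ideal_class_def class_group_def FactGroup_def)
  have "OK \<in> ?H" unfolding principal_fractional_ideals_def
    by (rule image_eqI[of _ _ 1]) auto
  hence "OK \<otimes>\<^bsub>fractional_ideal_group K\<^esub> N \<in> ?H #>\<^bsub>fractional_ideal_group K\<^esub> N"
    unfolding r_coset_def by blast
  hence "OK \<otimes>\<^bsub>fractional_ideal_group K\<^esub> N \<in> ?H" by (simp only: cl)
  moreover have "OK \<otimes>\<^bsub>fractional_ideal_group K\<^esub> N = N"
  proof
    have ops: "x \<otimes>\<^bsub>ring_of_type_algebra\<^esub> y = x * y" "x \<oplus>\<^bsub>ring_of_type_algebra\<^esub> y = x + y"
      for x y :: real
      by (simp_all add: ring_of_type_algebra_def)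
    have eq: "OK \<otimes>\<^bsub>fractional_ideal_group K\<^esub> N = ideal_prod (ring_on K) OK N"
      by (simp add: fractional_ideal_group_def)
    note N = idealD[OF I[folded N_def]]
    show "OK \<otimes>\<^bsub>fractional_ideal_group K\<^esub> N \<subseteq> N"
    proof
      fix x assume "x \<in> OK \<otimes>\<^bsub>fractional_ideal_group K\<^esub> N"
      thus "x \<in> N" unfolding eq
        by (induction rule: ideal_prod.induct) (simp_all add: ops N(3,4))
    qed
    show "N \<subseteq> OK \<otimes>\<^bsub>fractional_ideal_group K\<^esub> N"
    proof
      fix x assume "x \<in> N"
      from ideal_prod.prod[OF OK_consts(1) this, of "ring_on K"]
      show "x \<in> OK \<otimes>\<^bsub>fractional_ideal_group K\<^esub> N" unfolding eq by (simp add: ops)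
    qed
  qed
  ultimately have "N \<in> ?H" by simp
  then obtain a where "a \<in> K - {0}" "N = (\<lambda>w. a * w) ` carrier R"
    unfolding principal_fractional_ideals_def by blast
  thus ?thesis using that[of a] by (simp add: N_def principal_def)
qed

section \<open>Units, and square roots of ramified primes times units\<close>

definition units :: "real set" where "units = {u \<in> OK. u \<noteq> 0 \<and> inverse u \<in> OK}"

lemma unitsD: "u \<in> units \<Longrightarrow> u \<in> OK" "u \<in> units \<Longrightarrow> u \<noteq> 0" "u \<in> units \<Longrightarrow> inverse u \<in> OK"
  by (auto simp: units_def)

lemma units_mult [simp, intro]: "u \<in> units \<Longrightarrow> v \<in> units \<Longrightarrow> u * v \<in> units"
  by (auto simp: units_def)

lemma units_inverse [simp, intro]: "u \<in> units \<Longrightarrow> inverse u \<in> units"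
  by (auto simp: units_def)

lemma units_1 [simp]: "1 \<in> units" by (simp add: units_def)

lemma units_minus [simp, intro]: "u \<in> units \<Longrightarrow> - u \<in> units"
  by (auto simp: units_def inverse_minus_eq)

lemma units_power [simp, intro]: "u \<in> units \<Longrightarrow> u ^ n \<in> units"
  by (induction n) auto

lemma units_prod: "(\<And>i. i \<in> A \<Longrightarrow> f i \<in> units) \<Longrightarrow> prod f A \<in> units"
  by (induction A rule: infinite_finite_induct) auto

lemma units_conj [simp, intro]:
  assumes "u \<in> units" "e \<in> signs" "f \<in> signs"
  shows "conj e f u \<in> units"
proof -
  have u: "u \<in> K" using unitsD(1)[OF assms(1)] by blast
  show ?thesis
    using OK_conj[OF unitsD(1)[OF assms(1)] assms(2,3)] OK_conj[OF unitsD(3)[OF assms(1)] assms(2,3)]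
      conj_inverse[OF u assms(2,3)] conj_eq_0_iff[OF u assms(2,3)] unitsD(2)[OF assms(1)]
    by (simp add: units_def)
qed

lemma unitsI: "u \<in> OK \<Longrightarrow> v \<in> OK \<Longrightarrow> u * v = 1 \<Longrightarrow> u \<in> units"
  using inverse_unique[of u v] by (auto simp: units_def)

lemma units_sqrt:
  assumes "w \<in> K" "w\<^sup>2 \<in> units"
  shows "w \<in> units"
proof -
  have *: "y \<in> OK" if "y \<in> K" "y\<^sup>2 \<in> OK" for y
    using algebraic_int_root[of "y\<^sup>2" "monom 1 2" y] that by (simp add: OK_def poly_monom degree_monom_eq)
  have "w \<in> OK" using *[OF assms(1)] unitsD(1)[OF assms(2)] by blast
  moreover have "inverse w \<in> OK"
    using *[of "inverse w"] assms(1) unitsD(3)[OF assms(2)] by (simp add: power_inverse)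
  moreover have "w \<noteq> 0" using unitsD(2)[OF assms(2)] by auto
  ultimately show ?thesis by (simp add: units_def)
qed

lemma Nm_int: "x \<in> OK \<Longrightarrow> Nm x \<in> \<int>"
  by (rule OK_rat[OF _ Nm_rat]) (auto simp: Nm_def)

lemma Nm_of_nat: "Nm (of_nat n) = of_nat n ^ 4"
  by (simp add: Nm_def power4_eq_xxxx mult.assoc)

text \<open>Applying the involution \<open>conj e f\<close> to \<open>conj e f a = a * w\<close>
  gives \<open>a = a * (w * conj e f w)\<close>, so the inverse of \<open>w\<close> is its own
  conjugate.\<close>

lemma conj_ratio_unit:
  assumes "a \<in> OK" "a \<noteq> 0" "\<And>e f. e \<in> signs \<Longrightarrow> f \<in> signs \<Longrightarrow> conj e f a \<in> principal a"
    and ef: "e \<in> signs" "f \<in> signs"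
  obtains w where "w \<in> units" "conj e f a = a * w"
proof -
  obtain w where w: "w \<in> OK" "conj e f a = a * w" using assms(3)[OF ef] by (auto simp: principal_def)
  have "a = conj e f (a * w)" using conj_involution[of a e f] assms(1) ef w(2) by auto
  also have "\<dots> = a * (w * conj e f w)" using conj_mult[of a w e f] assms(1) w ef by (auto dest!: OK_K)
  finally have "w * conj e f w = 1" using assms(2) by simp
  hence "w \<in> units" using unitsI[OF w(1)] OK_conj[OF w(1) ef] by blast
  thus ?thesis using that w(2) by blast
qed

text \<open>The two extreme exponents are impossible: j = 0 would put the unit \<open>v\<close> into
  \<open>P\<close>, and j = 4 would make \<open>a\<close> associated to \<open>p\<close>, although
  the nilpotent \<open>x\<close> lies in every ideal of \<open>S\<close>, hence in (a), but not in
  (p). Only this last point uses ramification.\<close>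

lemma sqrt_of_ramified_prime_times_unit:
  assumes ram: "ramified_prime K p" and polya: "polya_field K"
  obtains b u where "b \<in> K" "u \<in> units" "b\<^sup>2 = of_nat p * u"
proof -
  have p: "Factorial_Ring.prime p" using ram by (simp add: ramified_prime_def)
  hence p0: "p > 0" by (rule prime_gt_0_nat)
  obtain P x where P: "maximalideal P R" "of_nat p \<in> P" and x: "x \<in> OK" "x \<notin> principal (of_nat p)"
    "x * x \<in> principal (of_nat p)"
    using ramified_witness[OF ram] .
  define q where "q = card (carrier (R Quot P))"
  define S where "S = {m. maximalideal m R \<and> card (carrier (R Quot m)) = q}"
  have S: "ostrowski_ideal K q = \<Inter>S" "\<And>m. m \<in> S \<Longrightarrow> of_nat p \<in> m" "q > 0"
    using ostrowski_ideal_eq_Inter[OF P p] unfolding S_def q_def by auto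
  have PS: "P \<in> S" using P by (simp add: S_def q_def)
  have "ideal (\<Inter>S) R"
    by (rule R.i_Intersect) (use PS in \<open>auto simp: S_def maximal_ideal\<close>)
  then obtain a where a: "a \<in> K" "a \<noteq> 0" "\<Inter>S = principal a"
    using polya_ostrowski_principal[OF polya S(3)] S(1) by metis
  have "a \<in> principal a" unfolding principal_def by (intro image_eqI[of _ _ 1]) auto
  hence aS: "a \<in> \<Inter>S" using a(3) by simp
  hence aP: "a \<in> P" using PS by blast
  hence aOK: "a \<in> OK" using idealD(1)[OF maximal_ideal[OF P(1)]] by blast
  have "of_nat p \<in> principal a" using S(2) a(3) by blast
  then obtain w0 where w0: "w0 \<in> OK" "of_nat p = a * w0" by (auto simp: principal_def)
  have conja: "conj e f a \<in> principal a" if ef: "e \<in> signs" "f \<in> signs" for e f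
  proof -
    have "conj e f a \<in> m" if m: "m \<in> S" for m
    proof -
      have mx: "maximalideal m R" using m by (simp add: S_def)
      have "conj e f ` m \<in> S"
        using m maximalideal_conj[OF mx ef] card_Quot_conj[OF maximal_ideal[OF mx] ef] by (simp add: S_def)
      hence "a \<in> conj e f ` m" using aS by blast
      then obtain y where "y \<in> m" "a = conj e f y" by blast
      moreover have "y \<in> K" using \<open>y \<in> m\<close> idealD(1)[OF maximal_ideal[OF mx]] by blast
      ultimately show ?thesis using conj_involution[OF _ ef] by metis
    qed
    thus ?thesis using a(3) by blast
  qed
  obtain w1 where w1: "w1 \<in> units" "conj (-1) 1 a = a * w1"
    using conj_ratio_unit[OF aOK a(2) conja, of "-1" 1] by auto
  obtain w2 where w2: "w2 \<in> units" "conj 1 (-1) a = a * w2"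
    using conj_ratio_unit[OF aOK a(2) conja, of 1 "-1"] by auto
  obtain w3 where w3: "w3 \<in> units" "conj (-1) (-1) a = a * w3"
    using conj_ratio_unit[OF aOK a(2) conja, of "-1" "-1"] by auto
  have "Nm a = a ^ 4 * (w1 * w2 * w3)"
    unfolding Nm_def w1(2) w2(2) w3(2) by (simp add: power4_eq_xxxx mult_ac)
  moreover obtain n where n: "Nm a = of_int n" using Nm_int[OF aOK] by (auto elim: Ints_cases)
  moreover obtain k where k: "Nm w0 = of_int k" using Nm_int[OF w0(1)] by (auto elim: Ints_cases)
  have "Nm a * Nm w0 = of_nat p ^ 4"
    using Nm_mult[OF a(1) OK_K[OF w0(1)]] Nm_of_nat[of p] unfolding w0(2) by simp
  hence "of_int (n * k) = (of_int (int (p ^ 4)) :: real)" unfolding n k by simp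
  hence "n * k = int (p ^ 4)" by (simp only: of_int_eq_iff)
  hence "nat \<bar>n\<bar> dvd p ^ 4" by (metis dvd_triv_left nat_abs_dvd_iff nat_int abs_of_nat dvd_nat_abs_iff int_dvd_int_iff)
  then obtain j where j: "j \<le> 4" "nat \<bar>n\<bar> = p ^ j" using divides_primepow_nat[OF p] by blast
  hence "n = int (p ^ j) \<or> n = - int (p ^ j)" by linarith
  hence nj: "(of_int n :: real) = of_nat p ^ j \<or> (of_int n :: real) = - (of_nat p ^ j)" by auto
  \<comment> \<open>The sign of the norm is absorbed into the unit.\<close>
  define v where "v = inverse (w1 * w2 * w3) * (if (of_int n :: real) = of_nat p ^ j then 1 else - 1)"
  have v: "v \<in> units" using w1 w2 w3 by (auto simp: v_def)
  have v0: "v \<noteq> 0" using unitsD(2)[OF v] .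
  have a4: "a ^ 4 = of_nat p ^ j * v"
    using calculation nj unitsD(2)[OF w1(1)] unitsD(2)[OF w2(1)] unitsD(2)[OF w3(1)]
    by (auto simp: v_def field_simps)
  have p4: "of_nat p ^ 4 = a ^ 4 * w0 ^ 4" using w0(2) by (simp add: power_mult_distrib)
  have pn0: "(of_nat p :: real) \<noteq> 0" using p0 by simp
  have iv: "v * inverse v = 1" using v0 by simp
  \<comment> \<open>The cases are numbered from 1, so case k treats j = k - 1.\<close>
  consider "j = 0" | "j = 1" | "j = 2" | "j = 3" | "j = 4" using j(1) by linarith
  thus ?thesis
  proof cases
    case 1
    have "a ^ 3 * a \<in> P" using idealD(4)[OF maximal_ideal[OF P(1)] _ aP, of "a ^ 3"] aOK by blast
    hence "v \<in> P" using a4 1 by (simp add: power4_eq_xxxx power3_eq_cube)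
    hence "inverse v * v \<in> P" using idealD(4)[OF maximal_ideal[OF P(1)] unitsD(3)[OF v]] by blast
    thus ?thesis using maximal_not_one[OF P(1)] v0 by simp
  next
    case 2
    have "(a\<^sup>2)\<^sup>2 = of_nat p * v" using a4 2 by simp
    thus ?thesis using that[of "a\<^sup>2" v] a(1) v by auto
  next
    case 3
    \<comment> \<open>The square of this quotient is the unit \<open>v\<close>, so the quotient is a
      unit, and already \<open>a\<close> is a square root of \<open>p\<close> times a unit.\<close>
    define w where "w = a\<^sup>2 / of_nat p"
    have "(a\<^sup>2)\<^sup>2 = (of_nat p)\<^sup>2 * v" using a4 3 by simp
    hence "w\<^sup>2 = v" using pn0 by (simp add: w_def power_divide)
    moreover have "w \<in> K" using a(1) by (auto simp: w_def)
    ultimately have "w \<in> units" using units_sqrt v by simp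
    moreover have "a\<^sup>2 = of_nat p * w" using pn0 by (simp add: w_def)
    ultimately show ?thesis using that a(1) by blast
  next
    case 4
    \<comment> \<open>Cancelling \<open>p ^ 3\<close> leaves \<open>p\<close> as a unit times
      \<open>w0 ^ 4\<close>, so the cofactor \<open>w0\<close> replaces \<open>a\<close>
      here.\<close>
    have "of_nat p ^ 3 * of_nat p = of_nat p ^ 3 * (v * w0 ^ 4)"
      using p4 a4 4 by (simp add: power4_eq_xxxx power3_eq_cube mult_ac)
    hence "of_nat p = v * w0 ^ 4" using pn0 by simp
    hence "(w0\<^sup>2)\<^sup>2 = of_nat p * inverse v" using v0 by (simp add: field_simps)
    thus ?thesis using that[of "w0\<^sup>2" "inverse v"] w0(1) v by auto
  next
    case 5
    \<comment> \<open>Now \<open>w0\<close> is a unit and (a) = (p), against the existence of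
      \<open>x\<close>.\<close>
    have "v * w0 ^ 4 = 1" using p4 a4 5 pn0 by simp
    hence "w0 * (v * w0 ^ 3) = 1" by (simp add: power4_eq_xxxx power3_eq_cube mult_ac)
    hence w0u: "w0 \<in> units" using unitsI[of w0 "v * w0 ^ 3"] w0(1) unitsD(1)[OF v] by blast
    have "x \<in> m" if m: "m \<in> S" for m
    proof -
      have mx: "maximalideal m R" using m by (simp add: S_def)
      have "principal (of_nat p) \<subseteq> m" using principal_subset_iff[OF maximal_ideal[OF mx]] S(2)[OF m] by blast
      thus ?thesis using maximal_prime[OF mx x(1) x(1)] x(3) by blast
    qed
    hence "x \<in> principal a" using a(3) by blast
    then obtain y where y: "y \<in> OK" "x = a * y" by (auto simp: principal_def)
    hence "x = of_nat p * (inverse w0 * y)" using w0(2) unitsD(2)[OF w0u] by simp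
    moreover have "inverse w0 * y \<in> OK" using y unitsD(3)[OF w0u] by blast
    ultimately show ?thesis using x(2) by (auto simp: principal_def)
  qed
qed

section \<open>Units\<close>

text \<open>For a nontrivial pair of signs this is the relative norm from \<open>K\<close> to the
  quadratic subfield fixed by \<open>conj e f\<close>.\<close>

definition rnorm :: "real \<times> real \<Rightarrow> real \<Rightarrow> real" where
  "rnorm = (\<lambda>(e,f) x. x * conj e f x)"

abbreviation nontrivial_signs :: "(real \<times> real) set" where
  "nontrivial_signs \<equiv> {(-1,1),(1,-1),(-1,-1)}"

lemma rnorm_mult: "x \<in> K \<Longrightarrow> y \<in> K \<Longrightarrow> j \<in> nontrivial_signs \<Longrightarrow> rnorm j (x * y) = rnorm j x * rnorm j y"
  by (auto simp: rnorm_def conj_mult)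

lemma rnorm_0_iff: "x \<in> K \<Longrightarrow> j \<in> nontrivial_signs \<Longrightarrow> rnorm j x = 0 \<longleftrightarrow> x = 0"
  by (auto simp: rnorm_def conj_eq_0_iff)

lemma rnorm_1: "rnorm j 1 = 1"
  by (cases j) (simp add: rnorm_def)

lemma K_powi [simp, intro]: "x \<in> K \<Longrightarrow> x powi k \<in> K"
  by (auto simp: power_int_def)

lemma units_powi [simp, intro]: "x \<in> units \<Longrightarrow> x powi k \<in> units"
  by (auto simp: power_int_def)

lemma units_K [dest]: "u \<in> units \<Longrightarrow> u \<in> K"
  using unitsD(1) OK_K by blast

lemma rnorm_powi:
  assumes "x \<in> K" "j \<in> nontrivial_signs"
  shows "rnorm j (x powi k) = rnorm j x powi k"
proof -
  have *: "conj e f (x powi k) = conj e f x powi k" if "e \<in> signs" "f \<in> signs" for e f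
    using that assms(1) conj_power[of x e f] conj_inverse[of x e f] conj_power[of "inverse x" e f]
    by (simp add: power_int_def)
  show ?thesis using assms(2) by (auto simp: rnorm_def * power_int_mult_distrib)
qed

lemma rnorm_prod:
  "finite A \<Longrightarrow> (\<And>i. i \<in> A \<Longrightarrow> g i \<in> K) \<Longrightarrow> j \<in> nontrivial_signs \<Longrightarrow> 
    prod g A \<in> K \<and> rnorm j (prod g A) = (\<Prod>i\<in>A. rnorm j (g i))"
  by (induction A rule: finite_induct) (simp_all add: rnorm_1 rnorm_mult)

lemma Nm_unit:
  assumes "u \<in> units"
  shows "Nm u = 1 \<or> Nm u = -1"
proof -
  have u: "u \<in> OK" "inverse u \<in> OK" "u \<noteq> 0" using unitsD[OF assms] by auto
  obtain a where a: "Nm u = of_int a" using Nm_int[OF u(1)] by (auto elim: Ints_cases)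
  obtain b where b: "Nm (inverse u) = of_int b" using Nm_int[OF u(2)] by (auto elim: Ints_cases)
  have "Nm u * Nm (inverse u) = Nm 1" using u by (subst Nm_mult[symmetric]) auto
  hence "of_int (a * b) = (of_int 1 :: real)" unfolding a b by (simp add: Nm_def)
  hence "a * b = 1" by (simp only: of_int_eq_iff)
  hence "a = 1 \<or> a = -1" by (auto simp: zmult_eq_1_iff)
  thus ?thesis unfolding a by auto
qed

text \<open>The relative norm w lies in a quadratic field. Its conjugate there has product
  \<open>Nm u\<close>, which is 1 or -1, with w, and their sum is a rational algebraic integer; so w
  + 1/w or w - 1/w is an integer.\<close>

lemma abs_rnorm_unit:
  assumes u: "u \<in> units" and j: "j \<in> nontrivial_signs"
    and near: "2 / 3 < \<bar>rnorm j u\<bar>" "\<bar>rnorm j u\<bar> < 3 / 2"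
  shows "\<bar>rnorm j u\<bar> = 1"
proof -
  define w where "w = rnorm j u"
  have uK: "u \<in> K" using u by blast
  \<comment> \<open>Any automorphism other than the identity and \<open>j\<close> restricts to the
    nontrivial automorphism of the field fixed by \<open>j\<close>.\<close>
  obtain e f where ef: "e \<in> signs" "f \<in> signs" "w * conj e f w = Nm u"
    "conj (-1) 1 (w + conj e f w) = w + conj e f w" "conj 1 (-1) (w + conj e f w) = w + conj e f w"
  proof -
    consider "j = (-1,1)" | "j = (1,-1)" | "j = (-1,-1)" using j by auto
    thus ?thesis
    proof cases
      case 1
      show ?thesis by (rule that[of 1 "-1"])
        (use uK in \<open>simp_all add: w_def 1 rnorm_def conj_mult conj_conj conj_add Nm_def\<close>)
    next
      case 2
      show ?thesis by (rule that[of "-1" 1])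
        (use uK in \<open>simp_all add: w_def 2 rnorm_def conj_mult conj_conj conj_add Nm_def\<close>)
    next
      case 3
      show ?thesis by (rule that[of 1 "-1"])
        (use uK in \<open>simp_all add: w_def 3 rnorm_def conj_mult conj_conj conj_add Nm_def\<close>)
    qed
  qed
  have wOK: "w \<in> OK" using j unitsD(1)[OF u] by (auto simp: w_def rnorm_def)
  hence sOK: "w + conj e f w \<in> OK" using ef by auto
  have "w + conj e f w \<in> \<int>" using OK_rat[OF sOK fixed_rat[OF OK_K[OF sOK] ef(4,5)]] .
  moreover have w0: "w \<noteq> 0" using rnorm_0_iff[OF uK j] unitsD(2)[OF u] by (simp add: w_def)
  have "conj e f w = Nm u / w" using ef(3) w0 by (simp add: nonzero_eq_divide_eq mult.commute)
  hence "conj e f w = 1 / w \<or> conj e f w = - (1 / w)" using Nm_unit[OF u] by auto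
  ultimately have "w + 1 / w \<in> \<int> \<or> w - 1 / w \<in> \<int>" by auto
  thus ?thesis using abs_eq_1_if_near_1[of w] near by (simp add: w_def)
qed

lemma unit_eq_pm_1:
  assumes u: "u \<in> units"
    and near: "\<And>j. j \<in> nontrivial_signs \<Longrightarrow> 2 / 3 < \<bar>rnorm j u\<bar> \<and> \<bar>rnorm j u\<bar> < 3 / 2"
  shows "\<bar>u\<bar> = 1"
proof -
  \<comment> \<open>The three relative norms contribute \<open>u\<close> three times and every other
    conjugate once.\<close>
  have eq: "u\<^sup>2 * Nm u = rnorm (-1,1) u * rnorm (1,-1) u * rnorm (-1,-1) u"
    by (simp add: rnorm_def Nm_def power2_eq_square mult_ac)
  have "\<bar>rnorm j u\<bar> = 1" if "j \<in> nontrivial_signs" for j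
    using abs_rnorm_unit[OF u that] near[OF that] by blast
  hence "\<bar>u\<^sup>2 * Nm u\<bar> = 1" unfolding eq abs_mult by simp
  moreover have "\<bar>Nm u\<bar> = 1" using Nm_unit[OF u] by auto
  ultimately have "u\<^sup>2 = 1" by (simp add: abs_mult)
  thus ?thesis by (simp add: abs_square_eq_1)
qed

lemma units_multiplicatively_dependent:
  assumes I: "finite I" "card I \<ge> 4" and u: "\<And>i. i \<in> I \<Longrightarrow> u i \<in> units"
  obtains c :: "'i \<Rightarrow> int" where "\<exists>i\<in>I. c i \<noteq> 0" "\<bar>\<Prod>i\<in>I. u i powi c i\<bar> = 1"
proof -
  \<comment> \<open>There is one linear form per quadratic subfield, three against at least four
    units. Dividing by \<open>ln (3 / 2)\<close> turns the bound 1 of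
    \<open>small_integer_combination\<close> into the window of \<open>unit_eq_pm_1\<close>.\<close>
  define L where "L = (\<lambda>j i. ln \<bar>rnorm j (u i)\<bar> / ln (3 / 2))"
  have "card nontrivial_signs \<le> 3" by (simp add: card_insert_if)
  hence lt: "card nontrivial_signs < card I" using I by linarith
  have fin: "finite nontrivial_signs" by simp
  obtain c where c: "\<exists>i\<in>I. c i \<noteq> 0"
    "\<forall>j\<in>nontrivial_signs. \<bar>\<Sum>i\<in>I. of_int (c i) * L j i\<bar> < 1"
    using small_integer_combination[OF I(1) fin lt, of L] by blast
  define x where "x = (\<Prod>i\<in>I. u i powi c i)"
  have x: "x \<in> units" unfolding x_def using u by (auto intro!: units_prod)
  have "2 / 3 < \<bar>rnorm j x\<bar> \<and> \<bar>rnorm j x\<bar> < 3 / 2" if j: "j \<in> nontrivial_signs" for j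
  proof -
    have nz: "rnorm j (u i) \<noteq> 0" if "i \<in> I" for i
      using rnorm_0_iff[OF _ j] unitsD(2)[OF u[OF that]] u[OF that] by blast
    have "rnorm j x = (\<Prod>i\<in>I. rnorm j (u i) powi c i)"
      unfolding x_def using rnorm_prod[OF I(1) _ j, of "\<lambda>i. u i powi c i"] u rnorm_powi[OF _ j]
      by (simp add: units_K)
    hence "ln \<bar>rnorm j x\<bar> = (\<Sum>i\<in>I. ln \<bar>rnorm j (u i) powi c i\<bar>)"
      using nz by (simp add: abs_prod ln_prod I(1))
    also have "\<dots> = (\<Sum>i\<in>I. of_int (c i) * ln \<bar>rnorm j (u i)\<bar>)"
      using nz by (intro sum.cong) (simp_all add: ln_abs_power_int)
    also have "\<dots> = (\<Sum>i\<in>I. of_int (c i) * L j i) * ln (3 / 2)"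
      by (simp add: L_def sum_distrib_right)
    finally have eq: "ln \<bar>rnorm j x\<bar> = (\<Sum>i\<in>I. of_int (c i) * L j i) * ln (3 / 2)" .
    have "ln (3 / 2 :: real) > 0" by simp
    hence "\<bar>(\<Sum>i\<in>I. of_int (c i) * L j i) * ln (3 / 2)\<bar> < 1 * ln (3 / 2)"
      unfolding abs_mult using bspec[OF c(2) j] by (simp only: abs_of_pos mult_strict_right_mono)
    hence "ln \<bar>rnorm j x\<bar> < ln (3 / 2)" "ln \<bar>rnorm j x\<bar> > - ln (3 / 2)"
      unfolding eq by linarith+
    moreover have "- ln (3 / 2 :: real) = ln (2 / 3)" using ln_inverse[of "3 / 2 :: real"] by simp
    moreover have "rnorm j x \<noteq> 0" using rnorm_0_iff[OF _ j] x unitsD(2)[OF x] by blast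
    ultimately show ?thesis by simp
  qed
  hence "\<bar>x\<bar> = 1" by (rule unit_eq_pm_1[OF x])
  thus ?thesis using that[OF c(1)] by (simp add: x_def)
qed

text \<open>This replaces the bound three for the unit rank in Dirichlet's theorem. The only input is that a unit
  whose three relative norms to the quadratic subfields are close to 1 in absolute value is \<open>1\<close> or \<open>-1\<close>.\<close>

lemma unit_subproduct_square:
  assumes I: "finite I" "card I \<ge> 4" and u: "\<And>i. i \<in> I \<Longrightarrow> u i \<in> units"
  obtains J v where "J \<subseteq> I" "J \<noteq> {}" "v \<in> units" "\<bar>\<Prod>i\<in>J. u i\<bar> = v\<^sup>2"
proof -
  have nz: "u i \<noteq> 0" if "i \<in> I" for i using unitsD(2)[OF u[OF that]] .
  \<comment> \<open>If all exponents are even they can be halved: the old product is the square of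
    the new one, whose absolute value is thus again 1. The sum of the absolute exponents drops, so
    an odd one eventually appears.\<close>
  have "\<exists>c. (\<exists>i\<in>I. odd (c i)) \<and> \<bar>\<Prod>i\<in>I. u i powi c i\<bar> = 1"
    if "\<exists>i\<in>I. c i \<noteq> 0" "\<bar>\<Prod>i\<in>I. u i powi c i\<bar> = 1" for c :: "_ \<Rightarrow> int"
    using that
  proof (induction "\<Sum>i\<in>I. nat \<bar>c i\<bar>" arbitrary: c rule: less_induct)
    case less
    show ?case
    proof (cases "\<exists>i\<in>I. odd (c i)")
      case False
      define d where "d = (\<lambda>i. c i div 2)"
      have cd: "c i = d i * 2" if "i \<in> I" for i using False that by (auto simp: d_def)
      have "(\<Prod>i\<in>I. u i powi c i) = (\<Prod>i\<in>I. (u i powi d i)\<^sup>2)"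
        by (intro prod.cong refl) (simp add: cd power_int_mult)
      also have "\<dots> = (\<Prod>i\<in>I. u i powi d i)\<^sup>2" by (simp add: prod_power_distrib)
      finally have "\<bar>\<Prod>i\<in>I. u i powi d i\<bar> = 1" using less.prems(2) by (simp add: abs_square_eq_1)
      moreover have "\<exists>i\<in>I. d i \<noteq> 0" using less.prems(1) cd by auto
      moreover have "(\<Sum>i\<in>I. nat \<bar>d i\<bar>) < (\<Sum>i\<in>I. nat \<bar>c i\<bar>)"
        using less.prems(1) by (intro sum_strict_mono_ex1 I(1)) (auto simp: cd)
      ultimately show ?thesis using less.hyps by blast
    qed (use less.prems in blast)
  qed
  moreover obtain c0 where "\<exists>i\<in>I. c0 i \<noteq> 0" "\<bar>\<Prod>i\<in>I. u i powi c0 i\<bar> = 1"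
    using units_multiplicatively_dependent[of I u, OF I u] .
  ultimately obtain c :: "_ \<Rightarrow> int" where c: "\<exists>i\<in>I. odd (c i)" "\<bar>\<Prod>i\<in>I. u i powi c i\<bar> = 1" by blast
  \<comment> \<open>Modulo squares only the odd exponents survive; the halves are collected in
    \<open>y\<close>, and \<open>v\<close> will be its inverse.\<close>
  define J where "J = {i \<in> I. odd (c i)}"
  define y where "y = (\<Prod>i\<in>I. u i powi (c i div 2))"
  have y: "y \<in> units" unfolding y_def using u by (auto intro!: units_prod)
  have "(\<Prod>i\<in>I. u i powi c i) = (\<Prod>i\<in>I. (u i powi (c i div 2))\<^sup>2 * (if odd (c i) then u i else 1))"
  proof (intro prod.cong refl)
    fix i assume i: "i \<in> I"
    have "c i = (c i div 2) * 2 + c i mod 2" by simp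
    hence "u i powi c i = u i powi ((c i div 2) * 2) * u i powi (c i mod 2)"
      using power_int_add[of "u i" "(c i div 2) * 2" "c i mod 2"] nz[OF i] by simp
    thus "u i powi c i = (u i powi (c i div 2))\<^sup>2 * (if odd (c i) then u i else 1)"
      by (auto simp: power_int_mult odd_iff_mod_2_eq_one even_iff_mod_2_eq_zero)
  qed
  also have "\<dots> = y\<^sup>2 * (\<Prod>i\<in>J. u i)"
    by (simp add: prod.distrib y_def prod_power_distrib J_def prod.inter_filter I(1))
  finally have "\<bar>y\<^sup>2 * (\<Prod>i\<in>J. u i)\<bar> = 1" using c(2) by simp
  hence "y\<^sup>2 * \<bar>\<Prod>i\<in>J. u i\<bar> = 1" by (simp add: abs_mult)
  hence "\<bar>\<Prod>i\<in>J. u i\<bar> = (inverse y)\<^sup>2" using inverse_unique[of "y\<^sup>2"] by (simp add: power_inverse)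
  thus ?thesis using that[of J "inverse y"] c(1) y by (auto simp: J_def)
qed

section \<open>Quadratic subfields\<close>

text \<open>The parity vectors of \<open>D1\<close> and \<open>D2\<close> span a plane, and two
  coordinates detect its nonzero vectors. If \<open>p1\<close> is odd in both, \<open>p2\<close> is
  chosen to detect the product; otherwise \<open>p1\<close> detects \<open>D1\<close> and the
  product, and \<open>p2\<close> is chosen for \<open>D2\<close>.\<close>

lemma prime_pair_of_odd_multiplicity:
  "\<exists>p1 p2 :: nat. \<forall>d\<in>{D1, D2, D1 * D2}.
    (Factorial_Ring.prime p1 \<and> odd (multiplicity p1 d)) \<or> (Factorial_Ring.prime p2 \<and> odd (multiplicity p2 d))"
proof -
  have mult: "multiplicity p (D1 * D2) = multiplicity p D1 + multiplicity p D2"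
    if "Factorial_Ring.prime p" for p
    using D_pos that by (intro prime_elem_multiplicity_mult_distrib) auto
  have s12: "(s1 * s2)\<^sup>2 = real (D1 * D2)" using s1 s2 by (simp add: power_mult_distrib)
  obtain p1 where p1: "Factorial_Ring.prime p1" "odd (multiplicity p1 D1)"
    using odd_multiplicity_if_sqrt_irrational[OF s1 irrational(1)] by blast
  show ?thesis
  proof (cases "odd (multiplicity p1 D2)")
    case True
    obtain p2 where "Factorial_Ring.prime p2" "odd (multiplicity p2 (D1 * D2))"
      using odd_multiplicity_if_sqrt_irrational[OF s12 irrational(3)] by blast
    thus ?thesis using p1 True by (intro exI[of _ p1] exI[of _ p2]) simp
  next
    case False
    obtain p2 where "Factorial_Ring.prime p2" "odd (multiplicity p2 D2)"
      using odd_multiplicity_if_sqrt_irrational[OF s2 irrational(2)] by blast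
    moreover have "odd (multiplicity p1 (D1 * D2))" using p1(2) False mult[OF p1(1)] by simp
    ultimately show ?thesis using p1 by (intro exI[of _ p1] exI[of _ p2]) simp
  qed
qed

text \<open>Every automorphism sends \<open>y\<close> to \<open>y\<close> or \<open>- y\<close>, so
  \<open>y\<close> is a common eigenvector of two generators of the Galois group, whose eigenspaces
  are the four coordinate lines.\<close>

lemma sqrt_of_rational_in_K:
  assumes "y \<in> K" "y\<^sup>2 \<in> \<rat>"
  obtains q \<chi> where "q \<in> \<rat>" "\<chi> \<in> {1, s1, s2, s1 * s2}" "y = q * \<chi>"
proof -
  obtain a b c d where y: "y = quad s1 s2 (a,b,c,d)" using assms(1) by (metis KE prod_cases4)
  have pm: "conj e f y = y \<or> conj e f y = - y" if "e \<in> signs" "f \<in> signs" for e f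
  proof -
    have "(conj e f y)\<^sup>2 = conj e f (y\<^sup>2)" using conj_power[OF assms(1) that] by simp
    also have "\<dots> = y\<^sup>2" by (rule conj_rat[OF assms(2)])
    finally show ?thesis by (simp add: power2_eq_iff)
  qed
  have neg: "- quad s1 s2 (a,b,c,d) = quad s1 s2 (-a,-b,-c,-d)" by (simp add: of_rat_minus)
  have "(-b = b \<and> -d = d) \<or> (-a = a \<and> -c = c)"
    using pm[of "-1" 1] unfolding y neg by (auto simp: conj_quad' inj_eq[OF inj_quad] simp del: quad.simps)
  moreover have "(-c = c \<and> -d = d) \<or> (-a = a \<and> -b = b)"
    using pm[of 1 "-1"] unfolding y neg by (auto simp: conj_quad' inj_eq[OF inj_quad] simp del: quad.simps)
  ultimately consider "b = 0" "c = 0" "d = 0" | "a = 0" "c = 0" "d = 0" | "a = 0" "b = 0" "d = 0"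
    | "a = 0" "b = 0" "c = 0" by auto
  thus ?thesis
  proof cases
    case 1 thus ?thesis using that[of "of_rat a" 1] y by simp
  next
    case 2 thus ?thesis using that[of "of_rat b" s1] y by simp
  next
    case 3 thus ?thesis using that[of "of_rat c" s2] y by simp
  next
    case 4 thus ?thesis using that[of "of_rat d" "s1 * s2"] y by simp
  qed
qed

lemma s_nonzero: "s1 \<noteq> 0" "s2 \<noteq> 0"
  using irrational by auto

lemma conj_s: 
  assumes "e \<in> signs" "f \<in> signs"
  shows "conj e f s1 = e * s1" "conj e f s2 = f * s2" "conj e f (s1 * s2) = (e * f) * (s1 * s2)"
proof -
  have "s1 = quad s1 s2 (0,1,0,0)" "s2 = quad s1 s2 (0,0,1,0)" by simp_all
  thus 1: "conj e f s1 = e * s1" "conj e f s2 = f * s2"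
    using conj_quad[of e f "(0,1,0,0)"] conj_quad[of e f "(0,0,1,0)"] by simp_all
  show "conj e f (s1 * s2) = (e * f) * (s1 * s2)"
    using conj_mult[OF s_in_K assms] 1 by simp
qed

text \<open>Every nontrivial automorphism fixes exactly one of the three roots, so the one that
  fixes \<psi> moves \<chi>.\<close>

lemma separating_conj:
  assumes "\<chi> \<in> {s1, s2, s1 * s2}"
  shows "\<exists>e\<in>signs. \<exists>f\<in>signs. conj e f \<chi> \<noteq> \<chi>"
    "\<psi> \<in> {s1, s2, s1 * s2} \<Longrightarrow> \<psi> \<noteq> \<chi> \<Longrightarrow> \<exists>e\<in>signs. \<exists>f\<in>signs. conj e f \<chi> \<noteq> \<chi> \<and> conj e f \<psi> = \<psi>"
proof -
  have A: "conj (-1) 1 s1 \<noteq> s1" "conj (-1) 1 s2 = s2" "conj (-1) 1 (s1 * s2) \<noteq> s1 * s2"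
    and B: "conj 1 (-1) s1 = s1" "conj 1 (-1) s2 \<noteq> s2" "conj 1 (-1) (s1 * s2) \<noteq> s1 * s2"
    and C: "conj (-1) (-1) s1 \<noteq> s1" "conj (-1) (-1) s2 \<noteq> s2" "conj (-1) (-1) (s1 * s2) = s1 * s2"
    using s_nonzero by (simp_all add: conj_s)
  show "\<exists>e\<in>signs. \<exists>f\<in>signs. conj e f \<chi> \<noteq> \<chi>"
    using assms A B C by (elim insertE emptyE; hypsubst; blast)
  show "\<exists>e\<in>signs. \<exists>f\<in>signs. conj e f \<chi> \<noteq> \<chi> \<and> conj e f \<psi> = \<psi>"
    if "\<psi> \<in> {s1, s2, s1 * s2}" "\<psi> \<noteq> \<chi>"
    using assms that A B C by (elim insertE emptyE; hypsubst; blast)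
qed

lemma ring_ring_on_K: "ring (ring_on K)"
proof -
  interpret F: Ring.field "ring_of_type_algebra :: real ring" ..
  have "subfield (generate_field ring_of_type_algebra {s1, s2}) ring_of_type_algebra"
    by (rule F.generate_field_is_subfield) (simp add: ring_of_type_algebra_def)
  thus ?thesis unfolding K_eq_generate_field using F.subring_is_ring subfieldE(1) by blast
qed

text \<open>Unrolling the inductive dimension predicate twice produces the rational basis
  \<open>w\<close>, \<open>v\<close>.\<close>

lemma quadratic_subfield_span:
  assumes F: "F \<in> quadratic_subfields K"
  obtains v w where "v \<in> K" "w \<in> K" "v \<noteq> 0" "\<forall>r\<in>\<rat>. w \<noteq> r * v"
    "F = {a * w + b * v | a b. a \<in> \<rat> \<and> b \<in> \<rat>}"
proof -
  interpret KR: ring "ring_on K" by (rule ring_ring_on_K)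
  have "KR.dimension (Suc (Suc 0)) \<rat> F" using F by (simp add: quadratic_subfields_def numeral_2_eq_2)
  moreover have split: "\<exists>v\<in>K. \<exists>E'. KR.dimension n \<rat> E' \<and> v \<notin> E' \<and> E = KR.line_extension \<rat> v E'"
    if "KR.dimension (Suc n) \<rat> E" for n E
    using that by (cases rule: KR.dimension.cases) auto
  ultimately obtain w E
    where w: "w \<in> K" "w \<notin> E" "KR.dimension (Suc 0) \<rat> E" "F = KR.line_extension \<rat> w E"
    by blast
  from split[OF w(3)] obtain v Z
    where v: "v \<in> K" "v \<notin> Z" "KR.dimension 0 \<rat> Z" "E = KR.line_extension \<rat> v Z"
    by blast
  have Z: "Z = {0}" using v(3) by (cases rule: KR.dimension.cases) auto
  have line: "KR.line_extension \<rat> x A = {a * x + b | a b. a \<in> \<rat> \<and> b \<in> A}" for x A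
  proof (intro equalityI subsetI)
    fix y assume "y \<in> KR.line_extension \<rat> x A"
    thus "y \<in> {a * x + b | a b. a \<in> \<rat> \<and> b \<in> A}"
      unfolding KR.line_extension_mem_iff by auto
  next
    fix y assume "y \<in> {a * x + b | a b. a \<in> \<rat> \<and> b \<in> A}"
    then obtain a b where "a \<in> \<rat>" "b \<in> A" "y = a * x + b" by blast
    thus "y \<in> KR.line_extension \<rat> x A"
      unfolding KR.line_extension_mem_iff by auto
  qed
  have E: "E = {b * v | b. b \<in> \<rat>}" unfolding v(4) line Z by auto
  show ?thesis
  proof (rule that)
    show "v \<in> K" "w \<in> K" using v(1) w(1) .
    show "v \<noteq> 0" using v(2) Z by simp
    show "\<forall>r\<in>\<rat>. w \<noteq> r * v" using w(2) unfolding E by blast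
    show "F = {a * w + b * v | a b. a \<in> \<rat> \<and> b \<in> \<rat>}"
      unfolding w(4) line unfolding E by blast
  qed
qed

text \<open>An irrational \<open>x\<close> in \<open>F\<close> gives the basis 1, \<open>x\<close>.
  Completing the square in its quadratic equation yields \<open>y\<close> with rational square, and
  \<open>sqrt_of_rational_in_K\<close> makes \<open>y\<close> a rational multiple of one of the
  three roots.\<close>

lemma quadratic_subfield_form:
  assumes F: "F \<in> quadratic_subfields K"
  obtains \<chi> where "\<chi> \<in> {s1, s2, s1 * s2}" "F = {a + b * \<chi> | a b. a \<in> \<rat> \<and> b \<in> \<rat>}"
proof -
  obtain v w where vw: "v \<in> K" "w \<in> K" "v \<noteq> 0" "\<forall>r\<in>\<rat>. w \<noteq> r * v"
    "F = {a * w + b * v | a b. a \<in> \<rat> \<and> b \<in> \<rat>}"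
    using quadratic_subfield_span[OF F] .
  have sub: "subfield F (ring_on K)" using F by (simp add: quadratic_subfields_def)
  have F1: "1 \<in> F" and Fm: "\<And>x y. x \<in> F \<Longrightarrow> y \<in> F \<Longrightarrow> x * y \<in> F"
    using subringE(3,6)[OF subfieldE(1)[OF sub]] by auto
  have Fadd: "x + y \<in> F" if "x \<in> F" "y \<in> F" for x y
    using subringE(7)[OF subfieldE(1)[OF sub] that] by simp
  have Fscale: "r * x \<in> F" if rx: "r \<in> \<rat>" "x \<in> F" for r x
  proof -
    obtain a b where "a \<in> \<rat>" "b \<in> \<rat>" "x = a * w + b * v" using rx(2) vw(5) by blast
    hence "r * x = (r * a) * w + (r * b) * v" "r * a \<in> \<rat>" "r * b \<in> \<rat>"
      using rx(1) by (simp_all add: algebra_simps)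
    thus ?thesis unfolding vw(5) by blast
  qed
  have FK: "F \<subseteq> K"
  proof
    fix x assume "x \<in> F"
    then obtain a b where "a \<in> \<rat>" "b \<in> \<rat>" "x = a * w + b * v" unfolding vw(5) by blast
    thus "x \<in> K" using vw(1,2) by (simp add: K_rat)
  qed
  have "\<exists>x\<in>F. x \<notin> \<rat>"
  proof (rule ccontr)
    assume "\<not> ?thesis"
    hence rat: "F \<subseteq> \<rat>" by blast
    have "w = 1 * w + 0 * v" "v = 0 * w + 1 * v" by simp_all
    hence "w \<in> F" "v \<in> F" unfolding vw(5) using Rats_0 Rats_1 by blast+
    hence "w / v \<in> \<rat>" using rat by (intro Rats_divide) auto
    thus False using bspec[OF vw(4), of "w / v"] vw(3) by simp
  qed
  then obtain x where x: "x \<in> F" "x \<notin> \<rat>" by blast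
  have Fx: "F = {a + b * x | a b. a \<in> \<rat> \<and> b \<in> \<rat>}"
  proof
    show "{a + b * x | a b. a \<in> \<rat> \<and> b \<in> \<rat>} \<subseteq> F"
      using Fadd Fscale[OF _ F1] Fscale[OF _ x(1)] by auto
    obtain a b where ab: "a \<in> \<rat>" "b \<in> \<rat>" "1 = a * w + b * v" using F1 vw(5) by blast
    obtain c d where cd: "c \<in> \<rat>" "d \<in> \<rat>" "x = c * w + d * v" using x(1) vw(5) by blast
    \<comment> \<open>The determinant of 1, \<open>x\<close> in the basis \<open>w\<close>,
      \<open>v\<close>, used for Cramer's rule; if it vanished, \<open>x\<close> would be
      rational.\<close>
    define D where "D = a * d - b * c"
    have "w * D = d * (a * w + b * v) - b * (c * w + d * v)"
      "v * D = a * (c * w + d * v) - c * (a * w + b * v)"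
      by (simp_all add: D_def algebra_simps)
    hence wD: "w * D = d - b * x" and vD: "v * D = a * x - c"
      by (simp_all only: ab(3)[symmetric] cd(3)[symmetric] mult_1_right)
    have "D \<noteq> 0"
    proof
      assume "D = 0"
      hence "d = b * x" "c = a * x" using wD vD by simp_all
      moreover have "a \<noteq> 0 \<or> b \<noteq> 0" using ab(3) by auto
      ultimately have "x = d / b \<or> x = c / a" by auto
      thus False using x(2) ab cd by (auto intro: Rats_divide)
    qed
    hence w: "w = (d - b * x) / D" and v: "v = (a * x - c) / D"
      unfolding wD[symmetric] vD[symmetric] by simp_all
    have Dr: "D \<in> \<rat>" using ab cd by (simp add: D_def)
    show "F \<subseteq> {a + b * x | a b. a \<in> \<rat> \<and> b \<in> \<rat>}"
    proof
      fix y assume "y \<in> F"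
      then obtain g h where gh: "g \<in> \<rat>" "h \<in> \<rat>" "y = g * w + h * v" unfolding vw(5) by blast
      have "y = (g * (d / D) + h * (- c / D)) + (g * (- b / D) + h * (a / D)) * x"
        unfolding gh(3) by (subst w, subst v) (simp add: diff_divide_distrib right_diff_distrib left_diff_distrib distrib_right mult.assoc)
      moreover have "g * (d / D) + h * (- c / D) \<in> \<rat>" "g * (- b / D) + h * (a / D) \<in> \<rat>"
        using gh ab cd Dr by auto
      ultimately show "y \<in> {a + b * x | a b. a \<in> \<rat> \<and> b \<in> \<rat>}" by blast
    qed
  qed
  obtain m n where mn: "m \<in> \<rat>" "n \<in> \<rat>" "x * x = m + n * x" using Fm[OF x(1) x(1)] Fx by blast
  define y where "y = x - n / 2"
  have "y\<^sup>2 = m + n\<^sup>2 / 4" using mn(3) by (simp add: y_def power2_eq_square algebra_simps)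
  hence "y\<^sup>2 \<in> \<rat>" using mn by simp
  moreover have "y \<in> K" unfolding y_def using subsetD[OF FK x(1)] mn(2) by (simp add: K_rat)
  ultimately obtain q \<chi> where q: "q \<in> \<rat>" "\<chi> \<in> {1, s1, s2, s1 * s2}" "y = q * \<chi>"
    using sqrt_of_rational_in_K[of y] by metis
  have xq: "x = n / 2 + q * \<chi>" using q(3) by (simp add: y_def)
  have "\<chi> \<noteq> 1" using x(2) xq q(1) mn(2) by auto
  have "q \<noteq> 0" using x(2) xq mn(2) by auto
  have "F = {a + b * \<chi> | a b. a \<in> \<rat> \<and> b \<in> \<rat>}"
  proof (intro equalityI subsetI)
    fix z assume "z \<in> F"
    then obtain a b where ab: "a \<in> \<rat>" "b \<in> \<rat>" "z = a + b * x" unfolding Fx by blast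
    hence "z = (a + b * n / 2) + (b * q) * \<chi>" by (simp add: xq algebra_simps)
    moreover have "a + b * n / 2 \<in> \<rat>" "b * q \<in> \<rat>" using ab q mn by auto
    ultimately show "z \<in> {a + b * \<chi> | a b. a \<in> \<rat> \<and> b \<in> \<rat>}" by blast
  next
    fix z assume "z \<in> {a + b * \<chi> | a b. a \<in> \<rat> \<and> b \<in> \<rat>}"
    then obtain a b where ab: "a \<in> \<rat>" "b \<in> \<rat>" "z = a + b * \<chi>" by blast
    have "\<chi> = (x - n / 2) / q" using xq \<open>q \<noteq> 0\<close> by simp
    hence "z = (a - b / q * (n / 2)) + (b / q) * x" using ab(3) by (simp add: diff_divide_distrib right_diff_distrib)
    moreover have "a - b / q * (n / 2) \<in> \<rat>" "b / q \<in> \<rat>" using ab q mn by auto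
    ultimately show "z \<in> F" unfolding Fx by blast
  qed
  thus ?thesis using that[of \<chi>] q(2) \<open>\<chi> \<noteq> 1\<close> by auto
qed

text \<open>A homomorphism fixes the rationals and sends \<chi> to plus or minus \<chi>, so the
  embeddings are the inclusion and the restriction of \<open>conj e f\<close>.\<close>

lemma field_norm_quadratic:
  assumes \<chi>: "\<chi> \<in> {s1, s2, s1 * s2}" and F: "F = {a + b * \<chi> | a b. a \<in> \<rat> \<and> b \<in> \<rat>}"
    and ef: "e \<in> signs" "f \<in> signs" and moved: "conj e f \<chi> \<noteq> \<chi>" and x: "x \<in> F"
  shows "field_norm F x = complex_of_real (x * conj e f x)"
proof -
  have \<chi>K: "\<chi> \<in> K" using \<chi> s_in_K by auto
  obtain D :: nat where D: "\<chi> * \<chi> = real D"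
  proof -
    have "s1 * s1 = real D1" "s2 * s2 = real D2" using s1 s2 by (simp_all add: power2_eq_square)
    hence "\<chi> * \<chi> = real D1 \<or> \<chi> * \<chi> = real D2 \<or> \<chi> * \<chi> = real (D1 * D2)"
      using \<chi> by (auto simp: mult_ac)
    thus ?thesis using that by blast
  qed
  have neg: "conj e f \<chi> = - \<chi>"
  proof -
    have "conj e f \<chi> * conj e f \<chi> = conj e f (\<chi> * \<chi>)" using conj_mult[OF \<chi>K \<chi>K ef] by simp
    also have "\<dots> = \<chi> * \<chi>" unfolding D by simp
    finally show ?thesis using moved by (auto simp: square_eq_iff)
  qed
  have FK: "F \<subseteq> K" using \<chi>K unfolding F by (auto simp: K_rat)
  have QF: "\<rat> \<subseteq> F"
  proof
    fix r :: real assume "r \<in> \<rat>"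
    moreover have "r = r + 0 * \<chi>" by simp
    ultimately show "r \<in> F" unfolding F using Rats_0 by blast
  qed
  have \<chi>F: "\<chi> \<in> F"
  proof -
    have "\<chi> = 0 + 1 * \<chi>" by simp
    thus ?thesis unfolding F using Rats_0 Rats_1 by blast
  qed
  define g where "g = (\<lambda>x\<in>F. complex_of_real x)"
  define g' where "g' = (\<lambda>x\<in>F. complex_of_real (conj e f x))"
  have F_closed: "u + v \<in> F" "u * v \<in> F" if uv: "u \<in> F" "v \<in> F" for u v
  proof -
    obtain a b c d where abcd: "a \<in> \<rat>" "b \<in> \<rat>" "c \<in> \<rat>" "d \<in> \<rat>" "u = a + b * \<chi>" "v = c + d * \<chi>"
      using uv unfolding F by blast
    have "u + v = (a + c) + (b + d) * \<chi>" using abcd(5,6) by (simp add: algebra_simps)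
    moreover have "a + c \<in> \<rat>" "b + d \<in> \<rat>" using abcd by auto
    ultimately show "u + v \<in> F" unfolding F by blast
    have "u * v = a * c + b * d * (\<chi> * \<chi>) + (a * d + b * c) * \<chi>"
      using abcd(5,6) by (simp add: algebra_simps)
    moreover have "a * c + b * d * (\<chi> * \<chi>) \<in> \<rat>" "a * d + b * c \<in> \<rat>" using abcd unfolding D by auto
    ultimately show "u * v \<in> F" unfolding F by blast
  qed
  have "complex_embeddings F = {g, g'}"
  proof (intro equalityI subsetI)
    fix h assume "h \<in> {g, g'}"
    moreover have "g \<in> complex_embeddings F"
      unfolding complex_embeddings_def Ring.ring_hom_def
      by (simp add: g_def F_closed QF[THEN subsetD])
    moreover have "g' \<in> complex_embeddings F"
      unfolding complex_embeddings_def Ring.ring_hom_def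
      by (simp add: g'_def F_closed QF[THEN subsetD] FK[THEN subsetD] conj_add conj_mult ef[simplified])
    ultimately show "h \<in> complex_embeddings F" by blast
  next
    fix h assume "h \<in> complex_embeddings F"
    hence h: "h \<in> Ring.ring_hom (ring_on F) ring_of_type_algebra" "h \<in> extensional F"
      by (auto simp: complex_embeddings_def)
    have rat: "h r = of_real r" if r: "r \<in> \<rat>" for r
      by (rule ring_hom_to_complex_rat[OF h(1) QF r])
    have lin: "h (a + b * \<chi>) = of_real a + of_real b * h \<chi>" if ab: "a \<in> \<rat>" "b \<in> \<rat>" for a b
    proof -
      have m: "a \<in> F" "b \<in> F" "b * \<chi> \<in> F" using ab QF F_closed(2) \<chi>F by auto
      show ?thesis
        using Ring.ring_hom_add[OF h(1), of a "b * \<chi>"] Ring.ring_hom_mult[OF h(1), of b \<chi>] m \<chi>F rat[OF ab(1)] rat[OF ab(2)]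
        by simp
    qed
    have "h \<chi> * h \<chi> = h (\<chi> * \<chi>)" using Ring.ring_hom_mult[OF h(1), of \<chi> \<chi>] \<chi>F by simp
    also have "\<dots> = of_real (\<chi> * \<chi>)" by (rule rat) (simp add: D)
    finally have "h \<chi> = of_real \<chi> \<or> h \<chi> = - of_real \<chi>" by (simp add: square_eq_iff)
    thus "h \<in> {g, g'}"
    proof
      assume h\<chi>: "h \<chi> = of_real \<chi>"
      have "h = g"
      proof (rule extensionalityI[OF h(2)])
        show "g \<in> extensional F" by (simp add: g_def)
        fix y assume y: "y \<in> F"
        then obtain a b where "a \<in> \<rat>" "b \<in> \<rat>" "y = a + b * \<chi>" unfolding F by blast
        thus "h y = g y" using y lin by (simp add: g_def h\<chi>)
      qed
      thus ?thesis by simp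
    next
      assume h\<chi>: "h \<chi> = - of_real \<chi>"
      have "h = g'"
      proof (rule extensionalityI[OF h(2)])
        show "g' \<in> extensional F" by (simp add: g'_def)
        fix y assume y: "y \<in> F"
        then obtain a b where ab: "a \<in> \<rat>" "b \<in> \<rat>" "y = a + b * \<chi>" unfolding F by blast
        have "conj e f y = a - b * \<chi>"
          using ab \<chi>K ef by (simp add: conj_add conj_mult K_rat conj_rat neg)
        thus "h y = g' y" using y ab lin by (simp add: g'_def h\<chi>)
      qed
      thus ?thesis by simp
    qed
  qed
  \<comment> \<open>The norm is a product over a set of embeddings; if the two coincided, it would
    have one factor only.\<close>
  moreover have "g \<noteq> g'"
  proof
    assume "g = g'"
    hence "g \<chi> = g' \<chi>" by simp
    thus False using moved \<chi>F by (simp add: g_def g'_def)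
  qed
  ultimately show ?thesis using x by (simp add: field_norm_def g_def g'_def)
qed

text \<open>An automorphism that moves \<chi> restricts to the nontrivial one of \<open>F\<close>,
  so multiplying \<open>u\<close> by its image gives the field norm. This sign pattern drives the
  independence argument.\<close>

lemma negative_norm_unit:
  assumes F: "F \<in> quadratic_subfields K" and eps: "fundamental_unit F u" "field_norm F u = -1"
  shows "u \<in> units" "\<exists>\<chi>\<in>{s1, s2, s1 * s2}. F = {a + b * \<chi> | a b. a \<in> \<rat> \<and> b \<in> \<rat>} \<and>
     (\<forall>e\<in>signs. \<forall>f\<in>signs. if conj e f \<chi> = \<chi> then conj e f u = u else u * conj e f u = -1)"
proof -
  obtain \<chi> where \<chi>: "\<chi> \<in> {s1, s2, s1 * s2}" "F = {a + b * \<chi> | a b. a \<in> \<rat> \<and> b \<in> \<rat>}"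
    using quadratic_subfield_form[OF F] .
  have \<chi>K: "\<chi> \<in> K" using \<chi> s_in_K by auto
  have FK: "F \<subseteq> K" using \<chi>K unfolding \<chi>(2) by (auto simp: K_rat)
  have "u \<in> Units (ring_of_integers F)" using eps(1) unfolding fundamental_unit_def by (rule conjunct1)
  then obtain v where uv: "u \<in> F" "v \<in> F" "algebraic_int u" "algebraic_int v" "u * v = 1"
    by (auto simp: Units_def ring_of_integers_def)
  show "u \<in> units"
    by (rule unitsI[of u v]) (use uv FK in \<open>auto simp: OK_def\<close>)
  have "if conj e f \<chi> = \<chi> then conj e f u = u else u * conj e f u = -1"
    if ef: "e \<in> signs" "f \<in> signs" for e f
  proof (cases "conj e f \<chi> = \<chi>")
    case True
    obtain a b where ab: "a \<in> \<rat>" "b \<in> \<rat>" "u = a + b * \<chi>" using uv(1) unfolding \<chi>(2) by blast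
    thus ?thesis using True ef \<chi>K by (simp add: conj_add conj_mult K_rat conj_rat)
  next
    case False
    have "complex_of_real (u * conj e f u) = complex_of_real (-1)"
      using field_norm_quadratic[OF \<chi> ef False uv(1)] eps(2) by simp
    hence "u * conj e f u = -1" by (simp only: of_real_eq_iff)
    thus ?thesis using False by simp
  qed
  thus "\<exists>\<chi>\<in>{s1, s2, s1 * s2}. F = {a + b * \<chi> | a b. a \<in> \<rat> \<and> b \<in> \<rat>} \<and>
     (\<forall>e\<in>signs. \<forall>f\<in>signs. if conj e f \<chi> = \<chi> then conj e f u = u else u * conj e f u = -1)"
    using \<chi> by blast
qed

section \<open>Independence of the units and the count\<close>

lemma conj_pos_if_square:
  assumes "b \<in> K" "b \<noteq> 0" "e \<in> signs" "f \<in> signs"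
  shows "conj e f (b\<^sup>2) > 0"
  using conj_eq_0_iff[OF assms(1,3,4)] assms(2) conj_power[OF assms(1,3,4), of 2] by simp

text \<open>For two units take an automorphism that moves one root and fixes the other: the first
  unit contributes -1, the second a square. Comparing the product with its conjugate, rather than
  asking for its sign, also excludes negatives of squares.\<close>

lemma not_totally_positive_if_negative_norm:
  fixes u :: "'i \<Rightarrow> real"
  assumes B: "finite B" "B \<noteq> {}" "card B \<le> 2"
    and u: "\<And>i. i \<in> B \<Longrightarrow> u i \<in> units" and \<chi>: "\<And>i. i \<in> B \<Longrightarrow> \<chi> i \<in> {s1, s2, s1 * s2}" "inj_on \<chi> B"
    and uc: "\<And>i e f. i \<in> B \<Longrightarrow> e \<in> signs \<Longrightarrow> f \<in> signs \<Longrightarrow>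
       if conj e f (\<chi> i) = \<chi> i then conj e f (u i) = u i else u i * conj e f (u i) = -1"
  shows "\<exists>e\<in>signs. \<exists>f\<in>signs. (\<Prod>i\<in>B. u i) * conj e f (\<Prod>i\<in>B. u i) < 0"
proof -
  obtain i where i: "i \<in> B" using B by blast
  show ?thesis
  proof (cases "B = {i}")
    case True
    obtain e f where ef: "e \<in> signs" "f \<in> signs" "conj e f (\<chi> i) \<noteq> \<chi> i"
      using separating_conj(1)[OF \<chi>(1)[OF i]] by blast
    have "u i * conj e f (u i) = -1" using uc[OF i ef(1,2)] ef(3) by simp
    thus ?thesis using True ef(1,2) by (intro bexI[OF _ ef(1)] bexI[OF _ ef(2)]) simp
  next
    case False
    then obtain j where j: "j \<in> B" "j \<noteq> i" using i by blast
    have "card {i, j} = 2" using j by simp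
    hence Bij: "B = {i, j}" using card_subset_eq[OF B(1), of "{i, j}"] i j B card_mono[OF B(1), of "{i, j}"] by auto
    have "\<chi> j \<noteq> \<chi> i" using inj_onD[OF \<chi>(2)] i j by blast
    then obtain e f where ef: "e \<in> signs" "f \<in> signs" "conj e f (\<chi> i) \<noteq> \<chi> i" "conj e f (\<chi> j) = \<chi> j"
      using separating_conj(2)[OF \<chi>(1)[OF i] \<chi>(1)[OF j(1)]] by blast
    have c: "u i * conj e f (u i) = -1" "conj e f (u j) = u j"
      using uc[OF i ef(1,2)] uc[OF j(1) ef(1,2)] ef(3,4) by simp_all
    have "(\<Prod>k\<in>B. u k) = u i * u j" using j by (simp add: Bij)
    hence "(\<Prod>k\<in>B. u k) * conj e f (\<Prod>k\<in>B. u k) = (u i * conj e f (u i)) * (u j * conj e f (u j))"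
      using conj_mult[of "u i" "u j" e f] u[OF i] u[OF j(1)] ef by (simp add: units_K mult_ac)
    also have "\<dots> = - (u j)\<^sup>2" using c by (simp add: power2_eq_square)
    also have "\<dots> < 0" using unitsD(2)[OF u[OF j(1)]] by simp
    finally show ?thesis by (intro bexI[OF _ ef(1)] bexI[OF _ ef(2)])
  qed
qed

text \<open>The product of \<open>A\<close> is a rational square times 1, \<open>D1\<close>,
  \<open>D2\<close> or \<open>D1 * D2\<close>. The last three have odd multiplicity at
  \<open>p1\<close> or \<open>p2\<close>, which \<open>A\<close> avoids; with 1, any prime of
  \<open>A\<close> has the wrong parity.\<close>

lemma ramified_primes_independent:
  assumes A: "finite A" "\<And>p. p \<in> A \<Longrightarrow> Factorial_Ring.prime p" "p1 \<notin> A" "p2 \<notin> A"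
    and p12: "\<forall>d\<in>{D1, D2, D1 * D2}.
      (Factorial_Ring.prime p1 \<and> odd (multiplicity p1 d)) \<or> (Factorial_Ring.prime p2 \<and> odd (multiplicity p2 d))"
    and y: "y \<in> K" "y\<^sup>2 = real (\<Prod>A)"
  shows "A = {}"
proof (rule ccontr)
  assume "A \<noteq> {}"
  then obtain r where r: "r \<in> A" by blast
  have pos: "\<Prod>A > 0" using A(2) by (intro prod_pos) (auto simp: prime_gt_0_nat)
  have "y\<^sup>2 \<in> \<rat>" unfolding y(2) by (rule Rats_of_nat)
  then obtain q \<chi> where q: "q \<in> \<rat>" "\<chi> \<in> {1, s1, s2, s1 * s2}" "y = q * \<chi>"
    using sqrt_of_rational_in_K[OF y(1)] by metis
  have sq: "1\<^sup>2 = real 1" "s1\<^sup>2 = real D1" "s2\<^sup>2 = real D2" "(s1 * s2)\<^sup>2 = real (D1 * D2)"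
    using s1 s2 by (simp_all add: power_mult_distrib)
  then obtain d where d: "d \<in> {1, D1, D2, D1 * D2}" "\<chi>\<^sup>2 = real d" using q(2) by blast
  have "d > 0" using d(1) D_pos by auto
  have eq: "real (\<Prod>A) = q\<^sup>2 * real d" using y(2) q(3) d(2) by (simp add: power_mult_distrib)
  note parity = parity_multiplicity_if_square_ratio[OF pos \<open>d > 0\<close> q(1) eq]
  show False
  proof (cases "d = 1")
    case True
    thus False using parity[OF A(2)[OF r]] multiplicity_prod_primes[OF A(1,2) A(2)[OF r]] r by simp
  next
    case False
    hence "d \<in> {D1, D2, D1 * D2}" using d(1) by simp
    from bspec[OF p12 this] obtain p
      where p: "Factorial_Ring.prime p" "odd (multiplicity p d)" "p \<notin> A"
      using A(3,4) by blast
    thus False using parity[OF p(1)] multiplicity_prod_primes[OF A(1,2) p(1)] by simp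
  qed
qed

lemma polya_ramified_bound:
  assumes polya: "polya_field K" and T: "finite T" "\<And>p. p \<in> T \<Longrightarrow> ramified_prime K p"
    and N: "finite N" "card N \<le> 2"
      "\<And>F. F \<in> N \<Longrightarrow> F \<in> quadratic_subfields K \<and> (\<exists>u. fundamental_unit F u \<and> field_norm F u = -1)"
  shows "card T + card N \<le> 5"
proof (rule ccontr)
  assume "\<not> ?thesis"
  \<comment> \<open>After discarding at most two primes, four units remain, one more than the rank
    allows.\<close>
  hence big: "card T + card N \<ge> 6" by simp
  obtain p1 p2 where p12: "\<forall>d\<in>{D1, D2, D1 * D2}.
      (Factorial_Ring.prime p1 \<and> odd (multiplicity p1 d)) \<or> (Factorial_Ring.prime p2 \<and> odd (multiplicity p2 d))"
    using prime_pair_of_odd_multiplicity by blast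
  define T' where "T' = T - {p1, p2}"
  have T': "finite T'" "T' \<subseteq> T" using T by (auto simp: T'_def)
  have "card T \<le> card T' + card {p1, p2}" unfolding T'_def using T(1)
    by (metis diff_card_le_card_Diff finite.emptyI finite.insertI le_diff_conv)
  moreover have "card {p1, p2} \<le> 2" by (simp add: card_insert_if)
  ultimately have cT: "card T' + 2 \<ge> card T" by linarith
  have "\<forall>p\<in>T. \<exists>b u. b \<in> K \<and> u \<in> units \<and> b\<^sup>2 = of_nat p * u"
    using sqrt_of_ramified_prime_times_unit[OF T(2) polya] by metis
  then obtain b w where bw: "\<And>p. p \<in> T \<Longrightarrow> b p \<in> K \<and> w p \<in> units \<and> (b p)\<^sup>2 = of_nat p * w p" by metis
  have pr: "Factorial_Ring.prime p" if "p \<in> T" for p using T(2)[OF that] by (simp add: ramified_prime_def)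
  define Q where "Q = (\<lambda>F u \<chi>. u \<in> units \<and> \<chi> \<in> {s1, s2, s1 * s2} \<and> F = {a + b * \<chi> | a b. a \<in> \<rat> \<and> b \<in> \<rat>} \<and>
     (\<forall>e\<in>signs. \<forall>f\<in>signs. if conj e f \<chi> = \<chi> then conj e f u = u else u * conj e f u = -1))"
  have "\<exists>u \<chi>. Q F u \<chi>" if F: "F \<in> N" for F
  proof -
    obtain u where u: "F \<in> quadratic_subfields K" "fundamental_unit F u" "field_norm F u = -1" using N(3)[OF F] by blast
    show ?thesis unfolding Q_def using negative_norm_unit[OF u] by blast
  qed
  then obtain u \<chi> where "\<And>F. F \<in> N \<Longrightarrow> Q F (u F) (\<chi> F)" by metis
  note u = this[unfolded Q_def]
  have inj: "inj_on \<chi> N"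
  proof (rule inj_onI)
    fix F G assume FG: "F \<in> N" "G \<in> N" "\<chi> F = \<chi> G"
    have "F = {a + b * \<chi> F | a b. a \<in> \<rat> \<and> b \<in> \<rat>}" "G = {a + b * \<chi> G | a b. a \<in> \<rat> \<and> b \<in> \<rat>}"
      using u[OF FG(1)] u[OF FG(2)] by blast+
    thus "F = G" using FG(3) by simp
  qed
  \<comment> \<open>The disjoint sum indexes both kinds of units at once and keeps equal values
    apart.\<close>
  define I where "I = T' <+> N"
  define z where "z = case_sum w u"
  have "finite I" "card I \<ge> 4" using T'(1) N(1) cT big by (simp_all add: I_def card_Plus)
  moreover have "z i \<in> units" if "i \<in> I" for i
    using that bw u T'(2) by (auto simp: I_def z_def)
  ultimately obtain J v where J: "J \<subseteq> I" "J \<noteq> {}" "v \<in> units" "\<bar>\<Prod>i\<in>J. z i\<bar> = v\<^sup>2"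
    using unit_subproduct_square[of I z] by metis
  define A where "A = {p. Inl p \<in> J}"
  define B where "B = {F. Inr F \<in> J}"
  have JAB: "J = A <+> B"
    by (auto simp: A_def B_def Plus_def) (metis sum.exhaust imageI UnI1 UnI2 mem_Collect_eq image_eqI)+
  have AB: "A \<subseteq> T'" "B \<subseteq> N" using J(1) by (auto simp: A_def B_def I_def)
  have fin: "finite A" "finite B" using AB T'(1) N(1) finite_subset by blast+
  have AT: "p \<in> T" if "p \<in> A" for p using that AB T' by blast
  have "(\<Prod>i\<in>J. z i) = (\<Prod>p\<in>A. w p) * (\<Prod>F\<in>B. u F)"
    unfolding JAB using fin by (simp add: prod.Plus z_def)
  hence abs: "\<bar>(\<Prod>p\<in>A. w p) * (\<Prod>F\<in>B. u F)\<bar> = v\<^sup>2" using J(4) by simp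
  define n where "n = real (\<Prod>A)"
  define bb where "bb = (\<Prod>p\<in>A. b p)"
  define W where "W = (\<Prod>p\<in>A. w p)"
  define E where "E = (\<Prod>F\<in>B. u F)"
  have n: "n > 0" "n \<in> \<rat>"
    unfolding n_def using pr AT by (auto intro!: prod_pos prime_gt_0_nat simp: of_nat_prod)
  have bbW: "bb\<^sup>2 = n * W"
    unfolding bb_def W_def n_def of_nat_prod prod_power_distrib prod.distrib[symmetric]
    by (intro prod.cong refl) (use bw AT in simp)
  have W: "W \<in> units" unfolding W_def using bw AT by (auto intro!: units_prod)
  hence W0: "W \<noteq> 0" by (rule unitsD)
  have E: "E \<in> units" unfolding E_def using u AB by (auto intro!: units_prod)
  have bb: "bb \<in> K" unfolding bb_def using conj_prod[OF fin(1), of b 1 1] bw AT by auto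
  have bb0: "bb \<noteq> 0" using bbW n W0 by auto
  \<comment> \<open>Conjugating \<open>n * W\<close>, the square of \<open>bb\<close>, only changes
    \<open>W\<close>, because \<open>n\<close> is rational; and \<open>n\<close> is
    positive.\<close>
  have Wpos: "conj e f W > 0" if ef: "e \<in> signs" "f \<in> signs" for e f
  proof -
    have "conj e f (bb\<^sup>2) = n * conj e f W"
      unfolding bbW using conj_mult[of n W e f] n W ef by (simp add: K_rat units_K conj_rat)
    thus ?thesis using conj_pos_if_square[OF bb bb0 ef] n by (simp add: zero_less_mult_iff)
  qed
  have "B = {}"
  proof (rule ccontr)
    assume "B \<noteq> {}"
    have "\<exists>e\<in>signs. \<exists>f\<in>signs. E * conj e f E < 0"
      unfolding E_def
    proof (rule not_totally_positive_if_negative_norm[OF fin(2) \<open>B \<noteq> {}\<close>, where \<chi> = \<chi>])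
      show "card B \<le> 2" using card_mono[OF N(1) AB(2)] N(2) by linarith
      show "inj_on \<chi> B" by (rule inj_on_subset[OF inj AB(2)])
      fix i assume "i \<in> B"
      hence "i \<in> N" using AB(2) by blast
      note ui = u[OF this]
      show "u i \<in> units" "\<chi> i \<in> {s1, s2, s1 * s2}" using ui by blast+
      show "if conj e f (\<chi> i) = \<chi> i then conj e f (u i) = u i else u i * conj e f (u i) = -1"
        if "e \<in> signs" "f \<in> signs" for e f using ui that by blast
    qed
    then obtain e f where ef: "e \<in> signs" "f \<in> signs" "E * conj e f E < 0" by blast
    \<comment> \<open>The sign hidden by the absolute value disappears when the number is multiplied
      by its conjugate.\<close>
    have "W * E = v\<^sup>2 \<or> W * E = - v\<^sup>2" using abs by (auto simp: W_def E_def abs_if split: if_splits)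
    moreover have vK: "v \<in> K" "v \<noteq> 0" using J(3) unitsD by blast+
    have "v\<^sup>2 * conj e f (v\<^sup>2) > 0" using conj_pos_if_square[OF vK ef(1,2)] vK by simp
    moreover have "conj e f (- v\<^sup>2) = - conj e f (v\<^sup>2)" using vK ef by (intro conj_minus) auto
    ultimately have "(W * E) * conj e f (W * E) > 0" by auto
    moreover have "conj e f (W * E) = conj e f W * conj e f E"
      using W E ef by (intro conj_mult) auto
    ultimately have "(W * conj e f W) * (E * conj e f E) > 0" by (simp add: mult_ac)
    moreover have "W > 0" using Wpos[of 1 1] W by (simp add: units_K)
    hence "W * conj e f W > 0" using Wpos[OF ef(1,2)] by simp
    hence "(W * conj e f W) * (E * conj e f E) < 0" using ef(3) by (rule mult_pos_neg)
    ultimately show False by linarith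
  qed
  hence "E = 1" by (simp add: E_def)
  have "W > 0" using Wpos[of 1 1] W by (simp add: units_K)
  hence "W = v\<^sup>2" using abs \<open>E = 1\<close> by (simp add: W_def E_def)
  moreover have "v \<noteq> 0" "v \<in> K" using J(3) unitsD by blast+
  ultimately have "(bb / v)\<^sup>2 = real (\<Prod>A)" "bb / v \<in> K"
    using bbW bb by (auto simp: power_divide n_def)
  hence "A = {}"
    using ramified_primes_independent[OF fin(1) _ _ _ p12, of "bb / v"] pr AT AB by (auto simp: T'_def)
  thus False using J(2) \<open>B = {}\<close> JAB by simp
qed

end

theorem corollary2p7:
  fixes K :: "real set" and t s :: nat
  assumes "real_biquadratic_field K"
    and "t = num_negative_norm_subfields K"
    and "s = num_ramified_primes K"
    and "polya_field K"
  shows "s \<le> (if t = 0 then 5 else if t = 1 then 4 else 3)"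
proof -
  obtain d1 d2 :: nat where d: "squarefree d1" "squarefree d2" "d1 \<noteq> 1" "d2 \<noteq> 1" "d1 \<noteq> d2"
    and K: "K = generate_field ring_of_type_algebra {sqrt (real d1), sqrt (real d2)}"
    using assms(1) unfolding real_biquadratic_field_def by blast
  interpret B: biquadratic "sqrt (real d1)" "sqrt (real d2)" d1 d2
    by unfold_locales
      (use d sqrt_squarefree_irrational sqrt_mult_squarefree_irrational in auto)
  have BK: "B.K = K" using B.K_eq_generate_field K by simp
  define T where "T = {p. ramified_prime K p}"
  define M where "M = {F \<in> quadratic_subfields K. \<exists>u. fundamental_unit F u \<and> field_norm F u = -1}"
  have s: "s = card T" and t: "t = card M"
    using assms(2,3) by (simp_all add: T_def M_def num_ramified_primes_def num_negative_norm_subfields_def)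
  obtain N where N: "N \<subseteq> M" "card N = min t 2" "finite N"
    using obtain_subset_with_card_n[of "min t 2" M] t by auto
  have "s + min t 2 \<le> 5"
  proof (cases "finite T")
    case True
    thus ?thesis
      using B.polya_ramified_bound[of T N] N assms(4) unfolding BK s T_def M_def by auto
  \<comment> \<open>For an infinite \<open>T\<close> the cardinality is 0 by convention, so the
    bound is immediate.\<close>
  qed (simp add: s)
  thus ?thesis by auto
qed

end
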